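(* Let $\widehat{\mathbf M}=(\hat{\mathbb{X}},\hat x_0,\hat{\mathbb{U}},\hat{\mathbf t},\hat h,\mathbb{Y})$ and $\mathbf M=(\mathbb{X},x_0,\mathbb{U},\mathbf t,h,\mathbb{Y})$ be gMDPs such that $\widehat{\mathbf M}\preceq^{\delta}_{\varepsilon}\mathbf M$, witnessed by a measurable relation $\mathcal{R}\subset\hat{\mathbb{X}}\times\mathbb{X}$, an interface function $\mathcal{I}$ and a sub-probability kernel $\boldsymbol v$. Then there exists a state mapping $\mathbf s$ that defines a valid control refinement (with respect to $\mathcal{I}$ and $\boldsymbol v$).
   Context: All state and input spaces are Polish spaces with Borel $\sigma$-algebras. A gMDP $\mathbf M=(\mathbb{X},x_0,\mathbb{U},\mathbf t,h,\mathbb{Y})$ consists of a state space $\mathbb{X}$, initial state $x_0\in\mathbb{X}$, input space $\mathbb{U}$, a probability kernel $\mathbf t(\cdot\mid x,u)$ on $\mathbb{X}$ for each $(x,u)\in\mathbb{X}\times\mathbb{U}$, an output space $\mathbb{Y}$ equipped with a metric $\mathbf d_{\mathbb{Y}}$, and a measurable output map $h:\mathbb{X}\to\mathbb{Y}$. An interface function is a Borel measurable stochastic kernel $\mathcal{I}(\cdot\mid\hat x,x,\hat u)$ on $\mathbb{U}$ indexed by $(\hat x,x,\hat u)\in\hat{\mathbb{X}}\times\mathbb{X}\times\hat{\mathbb{U}}$; we write $\mathbf t(\cdot\mid x,\mathcal{I}(\cdot\mid\hat x,x,\hat u)):=\int_{\mathbb{U}}\mathbf t(\cdot\mid x,u)\,\mathcal{I}(du\mid\hat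 x,x,\hat u)$. Given probability measures $\hat p$ on $\hat{\mathbb{X}}$, $p$ on $\mathbb{X}$, a relation $\mathcal{R}$ and $\delta\in[0,1]$, a sub-probability coupling of $\hat p$ and $p$ over $\mathcal{R}$ w.r.t. $\delta$ is a measure $v$ on $\hat{\mathbb{X}}\times\mathbb{X}$ with $1\ge v(\hat{\mathbb{X}}\times\mathbb{X})\ge 1-\delta$, $v(\hat{\mathbb{X}}\times\mathbb{X})=v(\mathcal{R})$, $v(A\times\mathbb{X})\le\hat p(A)$ and $v(\hat{\mathbb{X}}\times B)\le p(B)$ for all measurable $A\subset\hat{\mathbb{X}}$, $B\subset\mathbb{X}$. $\widehat{\mathbf M}\preceq^{\delta}_{\varepsilon}\mathbf M$ ($(\varepsilon,\delta)$-sub-simulation relation) means: there exist a measurable $\mathcal{R}\subset\hat{\mathbb{X}}\times\mathbb{X}$, an interface function $\mathcal{I}$ and a sub-probability kernel $\boldsymbol v(\cdot\mid\hat x,x,\hat u)$ on $\hat{\mathbb{X}}\times\mathbb{X}$ such that (a) $(\hat x_0,x_0)\in\mathcal{R}$; (b) for all $(\hat x,x)\in\mathcal{R}$ and $\hat u\in\hat{\mathbb{U}}$, $\boldsymbol v(\cdot\mid\hat x,x,\hat u)$ is a sub-probability coupling of $\hat{\mathbf t}(\cdot\mid\hat x,\hat u)$ and $\mathbf t(\cdot\mid x,\mathcal{I}(\cdot\mid\hat x,x,\hat u))$ over $\mathcal{R}$ w.r.t. $\delta$; (c) $\mathbf d_{\mathbb{Y}}(\hat h(\hat x),h(x))\le\varepsilon$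 for all $(\hat x,x)\in\mathcal{R}$. A state mapping is a kernel $\mathbf s(\cdot\mid\hat x,x,x^+,\hat u)$ assigning to each $(\hat x,x,x^+,\hat u)\in\hat{\mathbb{X}}\times\mathbb{X}\times\mathbb{X}\times\hat{\mathbb{U}}$ a probability measure on $\hat{\mathbb{X}}$. It defines a valid control refinement (w.r.t. $\mathcal{I}$, $\boldsymbol v$) if the composed measure $\mathbf t_\times(d\hat x^+\times dx^+\mid\hat x,x,\hat u):=\mathbf s(d\hat x^+\mid\hat x,x,x^+,\hat u)\,\mathbf t(dx^+\mid x,\mathcal{I}(\cdot\mid\hat x,x,\hat u))$ satisfies $\mathbf t_\times(A\mid\hat x,x,\hat u)\ge\boldsymbol v(A\mid\hat x,x,\hat u)$ for all measurable $A\subset\hat{\mathbb{X}}\times\mathbb{X}$, all $(\hat x,x)\in\mathcal{R}$ and all $\hat u\in\hat{\mathbb{U}}$. *)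

theory Defs
  imports "HOL-Probability.Probability"
begin

text \<open>Spaces are types of class polish_space, each carrying its Borel sigma-algebra.
  Products carry the product sigma-algebra (which agrees with the Borel sigma-algebra
  of the product for Polish spaces). The output space 'y is a metric space with metric dist.\<close>

record ('x, 'u, 'y) gmdp =
  init  :: "'x"
  trans :: "'x \<Rightarrow> 'u \<Rightarrow> 'x measure"
  out   :: "'x \<Rightarrow> 'y"

definition is_gmdp :: "('x::polish_space, 'u::polish_space, 'y::metric_space) gmdp \<Rightarrow> bool" where
  "is_gmdp M \<longleftrightarrow>
     (\<lambda>(x, u). trans M x u) \<in> measurable (borel \<Otimes>\<^sub>M borel) (prob_algebra borel) \<and>
     out M \<in> measurable borel borel"

definition interface_fun ::
  "('xh::polish_space \<Rightarrow> 'x::polish_space \<Rightarrow> 'uh::polish_space \<Rightarrow> 'u::polish_space measure) \<Rightarrow> bool" where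
  "interface_fun I \<longleftrightarrow>
     (\<lambda>(xh, x, uh). I xh x uh) \<in> measurable (borel \<Otimes>\<^sub>M borel \<Otimes>\<^sub>M borel) (prob_algebra borel)"

definition trans_I ::
  "('x \<Rightarrow> 'u \<Rightarrow> 'x measure) \<Rightarrow> ('xh \<Rightarrow> 'x \<Rightarrow> 'uh \<Rightarrow> 'u measure) \<Rightarrow> 'xh \<Rightarrow> 'x \<Rightarrow> 'uh \<Rightarrow> 'x measure" where
  "trans_I t I xh x uh = bind (I xh x uh) (\<lambda>u. t x u)"

definition sub_coupling ::
  "'xh::polish_space measure \<Rightarrow> 'x::polish_space measure \<Rightarrow> ('xh \<times> 'x) set \<Rightarrow> real \<Rightarrow> ('xh \<times> 'x) measure \<Rightarrow> bool" where
  "sub_coupling ph p R \<delta> v \<longleftrightarrow>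
     sets v = sets (borel \<Otimes>\<^sub>M borel) \<and>
     emeasure v (space v) \<le> 1 \<and>
     ennreal (1 - \<delta>) \<le> emeasure v (space v) \<and>
     emeasure v (space v) = emeasure v R \<and>
     (\<forall>A \<in> sets borel. emeasure v (A \<times> UNIV) \<le> emeasure ph A) \<and>
     (\<forall>B \<in> sets borel. emeasure v (UNIV \<times> B) \<le> emeasure p B)"

definition sub_sim_witness ::
  "('xh::polish_space, 'uh::polish_space, 'y::metric_space) gmdp \<Rightarrow> ('x::polish_space, 'u::polish_space, 'y) gmdp
   \<Rightarrow> real \<Rightarrow> real \<Rightarrow> ('xh \<times> 'x) set \<Rightarrow> ('xh \<Rightarrow> 'x \<Rightarrow> 'uh \<Rightarrow> 'u measure)
   \<Rightarrow> ('xh \<Rightarrow> 'x \<Rightarrow> 'uh \<Rightarrow> ('xh \<times> 'x) measure) \<Rightarrow> bool" where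
  "sub_sim_witness Mh M \<epsilon> \<delta> R I v \<longleftrightarrow>
     R \<in> sets (borel \<Otimes>\<^sub>M borel) \<and>
     interface_fun I \<and>
     (\<lambda>(xh, x, uh). v xh x uh) \<in> measurable (borel \<Otimes>\<^sub>M borel \<Otimes>\<^sub>M borel) (subprob_algebra (borel \<Otimes>\<^sub>M borel)) \<and>
     (init Mh, init M) \<in> R \<and>
     (\<forall>(xh, x) \<in> R. \<forall>uh.
        sub_coupling (trans Mh xh uh) (trans_I (trans M) I xh x uh) R \<delta> (v xh x uh)) \<and>
     (\<forall>(xh, x) \<in> R. dist (out Mh xh) (out M x) \<le> \<epsilon>)"

definition sub_sim ::
  "('xh::polish_space, 'uh::polish_space, 'y::metric_space) gmdp \<Rightarrow> real \<Rightarrow> real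
   \<Rightarrow> ('x::polish_space, 'u::polish_space, 'y) gmdp \<Rightarrow> bool" where
  "sub_sim Mh \<epsilon> \<delta> M \<longleftrightarrow> (\<exists>R I v. sub_sim_witness Mh M \<epsilon> \<delta> R I v)"

definition state_mapping ::
  "('xh::polish_space \<Rightarrow> 'x::polish_space \<Rightarrow> 'x \<Rightarrow> 'uh::polish_space \<Rightarrow> 'xh measure) \<Rightarrow> bool" where
  "state_mapping s \<longleftrightarrow>
     (\<lambda>(xh, x, x', uh). s xh x x' uh) \<in> measurable (borel \<Otimes>\<^sub>M borel \<Otimes>\<^sub>M borel \<Otimes>\<^sub>M borel) (prob_algebra borel)"

definition trans_times ::
  "('xh::polish_space \<Rightarrow> 'x::polish_space \<Rightarrow> 'x \<Rightarrow> 'uh \<Rightarrow> 'xh measure) \<Rightarrow> ('x \<Rightarrow> 'u \<Rightarrow> 'x measure)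
   \<Rightarrow> ('xh \<Rightarrow> 'x \<Rightarrow> 'uh \<Rightarrow> 'u measure) \<Rightarrow> 'xh \<Rightarrow> 'x \<Rightarrow> 'uh \<Rightarrow> ('xh \<times> 'x) measure" where
  "trans_times s t I xh x uh =
     bind (trans_I t I xh x uh) (\<lambda>x'. distr (s xh x x' uh) (borel \<Otimes>\<^sub>M borel) (\<lambda>y. (y, x')))"

definition valid_refinement ::
  "('xh::polish_space \<Rightarrow> 'x::polish_space \<Rightarrow> 'x \<Rightarrow> 'uh \<Rightarrow> 'xh measure) \<Rightarrow> ('x \<Rightarrow> 'u \<Rightarrow> 'x measure)
   \<Rightarrow> ('xh \<times> 'x) set \<Rightarrow> ('xh \<Rightarrow> 'x \<Rightarrow> 'uh \<Rightarrow> 'u measure)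
   \<Rightarrow> ('xh \<Rightarrow> 'x \<Rightarrow> 'uh \<Rightarrow> ('xh \<times> 'x) measure) \<Rightarrow> bool" where
  "valid_refinement s t R I v \<longleftrightarrow>
     (\<forall>(xh, x) \<in> R. \<forall>uh. \<forall>A \<in> sets (borel \<Otimes>\<^sub>M borel).
        emeasure (v xh x uh) A \<le> emeasure (trans_times s t I xh x uh) A)"

end

theory Submission
  imports Defs
begin

text \<open>
  Disintegrate the sub-coupling as \<open>v(dy\<^sup>+ dx\<^sup>+) = k(dy\<^sup>+ | x\<^sup>+) w(dx\<^sup>+)\<close>, where \<open>w\<close> is its second marginal,
  jointly measurably in \<open>(y, x, u)\<close> (\<open>y\<close>, \<open>u\<close> being the abstract state and input). Since \<open>w\<close> is dominated by \<open>t(\<cdot> | x, I)\<close>, the kernel \<open>k\<close> itself is a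
  valid state mapping; no density of \<open>w\<close> is involved.

  Conditional probabilities are obtained measurably in the parameter as limits of ratios on
  refining finite partitions, along a parameter-dependent fast subsequence. Coding a Polish space into
  \<open>[0, 1]\<close> and taking conditional quantiles turns them into a kernel.
\<close>

section \<open>Densities measurable in a parameter\<close>

text \<open>The obstacle is joint measurability. For each parameter a Radon-Nikodym density or a
  conditional law exists, but choosing one separately for every \<open>z\<close> gives no kernel,
  whereas \<open>state_mapping\<close> asks for measurability in all four arguments at once. Hence
  densities are explicit expressions in the measures of countably many sets, each measurable in
  \<open>z\<close>, and every index that varies with \<open>z\<close> is a least natural number. The
  cell ratios form a bounded martingale. Its increments are controlled in L2, so almost sure
  convergence is obtained along a subsequence with geometrically small increments; how fast it must
  run depends on the measures, hence on \<open>z\<close>. Quantiles settle a second difficulty: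
  conditional probabilities are fixed only up to a null set for each rational threshold, and on the
  bad points they need not form a distribution function. The infimum is still a measurable number
  there, so the image of the uniform law is a probability measure at every point, and the bad points
  do not affect the integral against \<open>w\<close>. Having a probability measure everywhere is
  what \<open>state_mapping\<close> demands, also where \<open>w\<close> carries no mass.\<close>

definition signature :: "(nat \<Rightarrow> 'a set) \<Rightarrow> nat \<Rightarrow> 'a \<Rightarrow> nat set" where
  "signature B n x = {i. i < n \<and> x \<in> B i}"

text \<open>The nonempty cells are the atoms of the algebra generated by the first \<open>n\<close>
  sets; they refine as \<open>n\<close> grows.\<close>

definition cell :: "(nat \<Rightarrow> 'a set) \<Rightarrow> nat \<Rightarrow> nat set \<Rightarrow> 'a set" where
  "cell B n S = {x. signature B n x = S}"

text \<open>When \<open>w\<close> dominates \<open>\<nu>\<close>, this is the conditional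
  expectation under \<open>w\<close> of the density of \<open>\<nu>\<close>, given the algebra of
  level \<open>n\<close>. Division by zero makes it 0 on \<open>w\<close>-null cells.\<close>

definition cell_ratio :: "(nat \<Rightarrow> 'a set) \<Rightarrow> 'a measure \<Rightarrow> 'a measure \<Rightarrow> nat \<Rightarrow> 'a \<Rightarrow> real" where
  "cell_ratio B \<nu> w n x =
     measure \<nu> (cell B n (signature B n x)) / measure w (cell B n (signature B n x))"

text \<open>Under domination this is the squared L2(\<open>w\<close>) norm of
  \<open>cell_ratio\<close> (see \<open>integral_f_times_f\<close>). Written as a finite sum over
  cells, it is visibly measurable in the two measures, which the choice of the subsequence relies
  on.\<close>

definition energy :: "(nat \<Rightarrow> 'a set) \<Rightarrow> 'a measure \<Rightarrow> 'a measure \<Rightarrow> nat \<Rightarrow> real" where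
  "energy B \<nu> w n = (\<Sum>S\<in>Pow {..<n}. (measure \<nu> (cell B n S))\<^sup>2 / measure w (cell B n S))"

lemma signature_subset: "signature B n x \<in> Pow {..<n}"
  by (auto simp: signature_def)

lemma signature_mono: "m \<le> n \<Longrightarrow> signature B m x = signature B n x \<inter> {..<m}"
  by (auto simp: signature_def)

lemma cell_measurable:
  assumes [measurable]: "\<And>i. B i \<in> sets (borel :: 'a::topological_space measure)"
  shows "cell B n S \<in> sets borel"
proof -
  have "cell B n S = {x. S \<subseteq> {..<n} \<and> (\<forall>i<n. x \<in> B i \<longleftrightarrow> i \<in> S)}"
    by (auto simp: cell_def signature_def)
  also have "\<dots> \<in> sets borel" by measurable
  finally show ?thesis .
qed

lemma cell_ratio_eq_sum:
  "cell_ratio B \<nu> w n x =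
     (\<Sum>S\<in>Pow {..<n}. measure \<nu> (cell B n S) / measure w (cell B n S) * indicator (cell B n S) x)"
proof -
  have "(\<Sum>S\<in>Pow {..<n}. measure \<nu> (cell B n S) / measure w (cell B n S) * indicator (cell B n S) x)
     = (\<Sum>S\<in>Pow {..<n}. if S = signature B n x then cell_ratio B \<nu> w n x else 0)"
    by (rule sum.cong) (auto simp: cell_ratio_def cell_def)
  also have "\<dots> = cell_ratio B \<nu> w n x"
    using signature_subset[of B n x] by (subst sum.delta) auto
  finally show ?thesis ..
qed

section \<open>Martingale and energy identities for one dominated pair of measures\<close>

locale dominated_measures =
  fixes B :: "nat \<Rightarrow> 'a::topological_space set" and \<nu> w :: "'a measure"
  assumes fin: "finite_measure w"
    and sets_w [simp, measurable_cong]: "sets w = sets borel"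
    and sets_nu [simp, measurable_cong]: "sets \<nu> = sets borel"
    and le: "A \<in> sets borel \<Longrightarrow> emeasure \<nu> A \<le> emeasure w A"
    and sets_B [measurable]: "B i \<in> sets borel"
    and generates: "sets (borel :: 'a measure) = sigma_sets UNIV (range B)"
begin

sublocale w: finite_measure w by (rule fin)

sublocale \<nu>: finite_measure \<nu>
proof
  have "emeasure \<nu> (space \<nu>) \<le> emeasure w (space \<nu>)"
    by (rule le) (metis sets.top sets_nu)
  then show "emeasure \<nu> (space \<nu>) \<noteq> \<infinity>"
    using w.emeasure_finite[of "space \<nu>"] by (auto simp: top_unique)
qed

abbreviation "f \<equiv> cell_ratio B \<nu> w"
abbreviation "J \<equiv> energy B \<nu> w"

lemma space_w [simp]: "space w = UNIV" and space_nu [simp]: "space \<nu> = UNIV"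
  by (metis sets_eq_imp_space_eq sets_w space_borel, metis sets_eq_imp_space_eq sets_nu space_borel)

lemma measure_le: "A \<in> sets borel \<Longrightarrow> measure \<nu> A \<le> measure w A"
  using le[of A] by (simp add: w.emeasure_eq_measure \<nu>.emeasure_eq_measure)

lemma measurable_cell [measurable]: "cell B n S \<in> sets borel"
  by (rule cell_measurable) measurable

lemma measurable_f [measurable]: "f n \<in> borel_measurable borel"
  unfolding cell_ratio_eq_sum[abs_def] by measurable

lemma f_nonneg: "0 \<le> f n x"
  by (simp add: cell_ratio_def)

lemma f_le_1: "f n x \<le> 1"
  using measure_le[OF measurable_cell, of n "signature B n x"]
  by (auto simp: cell_ratio_def divide_le_eq less_le)

lemma integrable_bounded [intro]:
  assumes "g \<in> borel_measurable borel" and "\<And>x. \<bar>g x :: real\<bar> \<le> c"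
  shows "integrable w g"
  using assms by (intro w.integrable_const_bound[where B = c]) auto

text \<open>On a \<open>w\<close>-null cell domination makes \<open>\<nu>\<close> vanish as well, so
  the convention 0/0 = 0 is consistent.\<close>

lemma ratio_times_measure:
  "measure \<nu> (cell B n S) / measure w (cell B n S) * measure w (cell B n S) = measure \<nu> (cell B n S)"
  using measure_le[OF measurable_cell, of n S] measure_nonneg[of \<nu> "cell B n S"]
  by (cases "measure w (cell B n S) = 0") (simp_all del: measure_nonneg add: order_antisym)

lemma ratio_le_1: "measure \<nu> (cell B n S) / measure w (cell B n S) \<le> 1"
  using measure_le[OF measurable_cell, of n S] by (auto simp: divide_le_eq less_le)

lemma measurable_signature_set: "{x. signature B n x \<in> T} \<in> sets borel"
proof -
  have "{x. signature B n x \<in> T} = (\<Union>S\<in>Pow {..<n} \<inter> T. cell B n S)"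
    using signature_subset[of B n] by (auto simp: cell_def)
  then show ?thesis by auto
qed

text \<open>The martingale property: a set visible at level \<open>m\<close> is a disjoint union of
  cells of the finer level \<open>n\<close>, and over each such cell the ratio integrates to the
  \<open>\<nu>\<close>-mass. \<open>T'\<close> collects the level-\<open>n\<close> signatures whose
  truncation lies in \<open>T\<close>.\<close>

lemma integral_f_indicator:
  assumes "m \<le> n"
  shows "(\<integral>x. f n x * indicator {x. signature B m x \<in> T} x \<partial>w) = measure \<nu> {x. signature B m x \<in> T}"
proof -
  define T' where "T' = {S. S \<inter> {..<m} \<in> T}"
  have A: "{x. signature B m x \<in> T} = {x. signature B n x \<in> T'}"
    using signature_mono[OF assms, of B] by (auto simp: T'_def)
  have "(\<integral>x. f n x * indicator {x. signature B n x \<in> T'} x \<partial>w)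
      = (\<integral>x. (\<Sum>S\<in>Pow {..<n} \<inter> T'. measure \<nu> (cell B n S) / measure w (cell B n S) * indicator (cell B n S) x) \<partial>w)"
  proof (rule Bochner_Integration.integral_cong[OF refl])
    fix x
    have "f n x * indicator {x. signature B n x \<in> T'} x =
       (\<Sum>S\<in>Pow {..<n}. if S \<in> T' then measure \<nu> (cell B n S) / measure w (cell B n S) * indicator (cell B n S) x else 0)"
      unfolding cell_ratio_eq_sum sum_distrib_right
      by (rule sum.cong) (auto simp: cell_def indicator_def)
    then show "f n x * indicator {x. signature B n x \<in> T'} x =
       (\<Sum>S\<in>Pow {..<n} \<inter> T'. measure \<nu> (cell B n S) / measure w (cell B n S) * indicator (cell B n S) x)"
      by (subst sum.inter_restrict) auto
  qed
  also have "\<dots> = (\<Sum>S\<in>Pow {..<n} \<inter> T'. measure \<nu> (cell B n S))"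
    by (subst Bochner_Integration.integral_sum)
       (auto simp: ratio_times_measure[simplified] ratio_le_1 intro!: w.integrable_const_bound[where B = 1] split: split_indicator)
  also have "\<dots> = measure \<nu> (\<Union>S\<in>Pow {..<n} \<inter> T'. cell B n S)"
    by (rule \<nu>.finite_measure_finite_Union[symmetric])
       (auto simp: disjoint_family_on_def cell_def[of B n] intro!: measurable_cell[unfolded cell_def])
  also have "(\<Union>S\<in>Pow {..<n} \<inter> T'. cell B n S) = {x. signature B n x \<in> T'}"
    using signature_subset[of B n] by (auto simp: cell_def)
  finally show ?thesis by (simp add: A)
qed

text \<open>Orthogonality of martingale increments: \<open>f n\<close> is constant on
  level-\<open>n\<close> cells, and there the finer \<open>f m\<close> has the same integral as
  \<open>f n\<close>. The inner product therefore depends on the coarser level only.\<close>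

lemma integral_f_times_f:
  assumes "n \<le> m"
  shows "(\<integral>x. f n x * f m x \<partial>w) = J n"
proof -
  have *: "(\<integral>x. f m x * indicator (cell B n S) x \<partial>w) = measure \<nu> (cell B n S)" for S
    using integral_f_indicator[OF assms, of "{S}"] by (simp add: cell_def)
  have int: "integrable w (\<lambda>x. c * (f m x * indicator (cell B n S) x))" for c S
    by (intro integrable_mult_right integrable_bounded[where c = 1])
       (auto simp: f_nonneg f_le_1 split: split_indicator)
  have "(\<integral>x. f n x * f m x \<partial>w) =
    (\<integral>x. (\<Sum>S\<in>Pow {..<n}. measure \<nu> (cell B n S) / measure w (cell B n S) * (f m x * indicator (cell B n S) x)) \<partial>w)"
    unfolding cell_ratio_eq_sum[of B \<nu> w n] sum_distrib_right by (simp add: mult_ac)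
  also have "\<dots> = (\<Sum>S\<in>Pow {..<n}. measure \<nu> (cell B n S) / measure w (cell B n S) * measure \<nu> (cell B n S))"
    by (subst Bochner_Integration.integral_sum[OF int]) (simp only: integral_mult_right_zero *)
  finally show ?thesis by (simp add: energy_def power2_eq_square)
qed

text \<open>Pythagoras: expanding the square, the mixed term contributes \<open>- 2 * J n\<close>.
  Energies thus increase, and their gaps measure L2 distances.\<close>

lemma integral_diff_square:
  assumes "n \<le> m"
  shows "(\<integral>x. (f n x - f m x)\<^sup>2 \<partial>w) = J m - J n"
proof -
  have int: "integrable w (\<lambda>x. f i x * f j x)" for i j
    using f_nonneg f_le_1 by (intro integrable_bounded[where c = 1]) (auto simp: abs_mult intro!: mult_le_one)
  have "(\<integral>x. (f n x - f m x)\<^sup>2 \<partial>w) = (\<integral>x. (f n x * f n x + f m x * f m x) - 2 * (f n x * f m x) \<partial>w)"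
    by (simp add: power2_eq_square algebra_simps)
  also have "\<dots> = (J n + J m) - 2 * J n"
    using int by (simp add: integral_f_times_f assms)
  finally show ?thesis by simp
qed

lemma J_mono: "n \<le> m \<Longrightarrow> J n \<le> J m"
  using integral_diff_square[of n m] integral_nonneg_AE[of "\<lambda>x. (f n x - f m x)\<^sup>2" w] by simp

lemma J_bounded: "J n \<le> measure w UNIV"
proof -
  have "J n = (\<integral>x. f n x * f n x \<partial>w)" by (simp add: integral_f_times_f)
  also have "\<dots> \<le> (\<integral>x. 1 \<partial>w)"
    using f_nonneg f_le_1
    by (intro integral_mono integrable_bounded[where c = 1]) (auto simp: abs_mult intro!: mult_le_one)
  finally show ?thesis by simp
qed

text \<open>Along indices whose energies approach the supremum geometrically, the martingale of cell
  ratios converges almost everywhere; no maximal inequality is needed.\<close>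

lemma AE_convergent_cell_ratio:
  assumes N: "\<And>k n. J n \<le> J (N k) + (1/4)^k"
  shows "AE x in w. convergent (\<lambda>k. f (N k) x)"
proof -
  define d where "d k x = f (N (Suc k)) x - f (N k) x" for k x
  have d [measurable]: "d k \<in> borel_measurable borel" for k unfolding d_def by measurable
  have d_le: "\<bar>d k x\<bar> \<le> 1" for k x
    using f_nonneg[of "N (Suc k)" x] f_nonneg[of "N k" x] f_le_1[of "N (Suc k)" x] f_le_1[of "N k" x]
    by (simp add: d_def)
  \<comment> \<open>\<open>N\<close> is not assumed monotone. If it decreases at \<open>k\<close>,
    the energy gap has the opposite sign and is bounded by the hypothesis at \<open>Suc k\<close>
    instead.\<close>
  have sq: "(\<integral>x. (d k x)\<^sup>2 \<partial>w) \<le> (1/4)^k" for k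
  proof (cases "N k \<le> N (Suc k)")
    case True
    then show ?thesis
      using integral_diff_square[of "N k" "N (Suc k)"] N[of "N (Suc k)" k]
      by (simp add: d_def power2_commute)
  next
    case False
    have "(1/4 :: real)^Suc k \<le> (1/4)^k" by simp
    with N[of "N k" "Suc k"] have "J (N k) - J (N (Suc k)) \<le> (1/4)^k" by linarith
    then show ?thesis
      using integral_diff_square[of "N (Suc k)" "N k"] False by (simp add: d_def)
  qed
  \<comment> \<open>The weight \<open>2^k\<close> balances the two terms: the squares contribute
    \<open>2^k * (1/4)^k\<close> and the constant contributes \<open>(1/2)^k\<close> times the total
    mass, both summable. This is why the energies are taken within \<open>(1/4)^k\<close>.\<close>
  have int_abs: "(\<integral>x. \<bar>d k x\<bar> \<partial>w) \<le> (1/2)^k * (1 + measure w UNIV)" for k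
  proof -
    have "(\<integral>x. \<bar>d k x\<bar> \<partial>w) \<le> (\<integral>x. 2^k * (d k x)\<^sup>2 + (1/2)^k \<partial>w)"
    proof (rule integral_mono)
      show "integrable w (\<lambda>x. \<bar>d k x\<bar>)" using d_le by (intro integrable_bounded[where c = 1]) auto
      show "integrable w (\<lambda>x. 2^k * (d k x)\<^sup>2 + (1/2)^k)"
        using d_le by (intro Bochner_Integration.integrable_add integrable_mult_right integrable_bounded[where c = 1])
          (auto simp: abs_square_le_1 power_le_one)
      fix x
      \<comment> \<open>AM-GM\<close>
      have "0 \<le> (2^k * \<bar>d k x\<bar> - 1)\<^sup>2" by simp
      also have "\<dots> = 2^k * (2^k * (d k x)\<^sup>2 + (1/2)^k - 2 * \<bar>d k x\<bar>)"
        by (simp add: power2_diff power_mult_distrib algebra_simps power2_eq_square power_one_over)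
      finally have "2 * \<bar>d k x\<bar> \<le> 2^k * (d k x)\<^sup>2 + (1/2)^k"
        by (subst (asm) mult_le_cancel_left_pos[of "2^k" 0, simplified]) simp_all
      then show "\<bar>d k x\<bar> \<le> 2^k * (d k x)\<^sup>2 + (1/2)^k" by linarith
    qed
    also have "\<dots> = 2^k * (\<integral>x. (d k x)\<^sup>2 \<partial>w) + (1/2)^k * measure w UNIV"
      using d_le by (subst Bochner_Integration.integral_add)
        (auto intro!: integrable_mult_right integrable_bounded[where c = 1] simp: abs_square_le_1)
    also have "\<dots> \<le> 2^k * (1/4)^k + (1/2)^k * measure w UNIV"
      using sq by simp
    also have "2^k * (1/4)^k = (1/2 :: real)^k" by (simp add: power_mult_distrib[symmetric])
    finally show ?thesis by (simp add: algebra_simps)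
  qed
  have "(\<integral>\<^sup>+x. (\<Sum>k. ennreal \<bar>d k x\<bar>) \<partial>w) = (\<Sum>k. \<integral>\<^sup>+x. ennreal \<bar>d k x\<bar> \<partial>w)"
    by (rule nn_integral_suminf) measurable
  also have "\<dots> \<le> (\<Sum>k. ennreal ((1/2)^k * (1 + measure w UNIV)))"
  proof (intro suminf_le allI)
    fix k
    have "(\<integral>\<^sup>+x. ennreal \<bar>d k x\<bar> \<partial>w) = ennreal (\<integral>x. \<bar>d k x\<bar> \<partial>w)"
      using d_le by (intro nn_integral_eq_integral integrable_bounded[where c = 1]) auto
    then show "(\<integral>\<^sup>+x. ennreal \<bar>d k x\<bar> \<partial>w) \<le> ennreal ((1/2)^k * (1 + measure w UNIV))"
      using int_abs by (simp add: ennreal_leI)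
  qed auto
  also have "\<dots> < \<infinity>"
    by (subst suminf_ennreal2) (auto intro!: summable_mult2 summable_geometric simp: less_top[symmetric])
  finally have "AE x in w. (\<Sum>k. ennreal \<bar>d k x\<bar>) \<noteq> \<infinity>"
    by (intro nn_integral_PInf_AE) auto
  then show ?thesis
  proof eventually_elim
    fix x assume "(\<Sum>k. ennreal \<bar>d k x\<bar>) \<noteq> \<infinity>"
    then have "summable (\<lambda>k. \<bar>d k x\<bar>)" by (intro summable_suminf_not_top) auto
    then have "summable (\<lambda>k. d k x)" by (rule summable_rabs_cancel)
    then have "summable (\<lambda>k. f (N (Suc k)) x - f (N k) x)" by (simp add: d_def)
    then show "convergent (\<lambda>k. f (N k) x)"
      unfolding summable_iff_convergent sum_lessThan_telescope[of "\<lambda>k. f (N k) x"]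
      by (simp add: convergent_diff_const_right_iff)
  qed
qed

text \<open>Signature sets are a generating family closed under intersection. On one of level
  \<open>n\<close>, the integrals of \<open>f (N k)\<close> already equal the
  \<open>\<nu>\<close>-mass once \<open>n \<le> k\<close>, because \<open>k \<le> N k\<close>;
  dominated convergence carries this to the limit. The clamp to [0, 1] gives bounds also at points
  where \<open>lim\<close> is unspecified.\<close>

lemma nu_eq_density:
  assumes N: "\<And>k n. J n \<le> J (N k) + (1/4)^k" and Nk: "\<And>k. k \<le> N k"
  shows "\<nu> = density w (\<lambda>x. ennreal (max 0 (min 1 (lim (\<lambda>k. f (N k) x)))))"
    (is "_ = density w (\<lambda>x. ennreal (?\<rho> x))")
proof -
  let ?E = "{{x. signature B n x \<in> T} | n T. True}"
  have [measurable]: "?\<rho> \<in> borel_measurable borel" by measurable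
  have lim: "AE x in w. (\<lambda>k. f (N k) x) \<longlonglongrightarrow> ?\<rho> x"
    using AE_convergent_cell_ratio[OF N]
  proof eventually_elim
    fix x assume "convergent (\<lambda>k. f (N k) x)"
    then have L: "(\<lambda>k. f (N k) x) \<longlonglongrightarrow> lim (\<lambda>k. f (N k) x)" by (simp add: convergent_LIMSEQ_iff)
    moreover have "0 \<le> lim (\<lambda>k. f (N k) x)" using L f_nonneg by (intro LIMSEQ_le_const) auto
    moreover have "lim (\<lambda>k. f (N k) x) \<le> 1" using L f_le_1 by (intro LIMSEQ_le_const2) auto
    ultimately show "(\<lambda>k. f (N k) x) \<longlonglongrightarrow> ?\<rho> x" by simp
  qed
  have sig: "sets (borel :: 'a measure) = sigma_sets UNIV ?E"
  proof
    show "sets (borel :: 'a measure) \<subseteq> sigma_sets UNIV ?E"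
      unfolding generates
    proof (rule sigma_sets_mono', safe)
      fix i
      \<comment> \<open>Level \<open>n\<close> records only indices below \<open>n\<close>, so
        \<open>B i\<close> first becomes visible at level \<open>Suc i\<close>.\<close>
      have "B i = {x. signature B (Suc i) x \<in> {S. i \<in> S}}" by (auto simp: signature_def)
      then show "\<exists>n T. B i = {x. signature B n x \<in> T} \<and> True" by blast
    qed
    show "sigma_sets UNIV ?E \<subseteq> sets (borel :: 'a measure)"
      using measurable_signature_set sets.sigma_sets_subset[of ?E "borel :: 'a measure"] by auto
  qed
  show ?thesis
  proof (rule measure_eqI_generator_eq[where E = ?E and \<Omega> = UNIV and A = "\<lambda>_. UNIV"])
    show "Int_stable ?E"
    proof (intro Int_stableI, clarify)
      fix n m :: nat and T U
      define T' where "T' = {S. S \<inter> {..<n} \<in> T \<and> S \<inter> {..<m} \<in> U}"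
      have "{x. signature B n x \<in> T} \<inter> {x. signature B m x \<in> U} = {x. signature B (max n m) x \<in> T'}"
        using signature_mono[of n "max n m" B] signature_mono[of m "max n m" B] by (auto simp: T'_def)
      then show "\<exists>n' T'. {x. signature B n x \<in> T} \<inter> {x. signature B m x \<in> U} = {x. signature B n' x \<in> T'} \<and> True"
        by blast
    qed
    fix X assume "X \<in> ?E"
    then obtain n T where X: "X = {x. signature B n x \<in> T}" by blast
    have [measurable]: "X \<in> sets borel" unfolding X by (rule measurable_signature_set)
    have "(\<lambda>k. \<integral>x. f (N k) x * indicator X x \<partial>w) \<longlonglongrightarrow> (\<integral>x. ?\<rho> x * indicator X x \<partial>w)"
    proof (rule integral_dominated_convergence[where w = "\<lambda>_. 1"])
      show "AE x in w. (\<lambda>k. f (N k) x * indicator X x) \<longlonglongrightarrow> ?\<rho> x * indicator X x"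
        using lim by eventually_elim (auto intro: tendsto_mult_right)
    qed (auto simp: f_nonneg f_le_1 split: split_indicator)
    moreover have "(\<lambda>k. \<integral>x. f (N k) x * indicator X x \<partial>w) \<longlonglongrightarrow> measure \<nu> X"
    proof (rule tendsto_eventually)
      show "\<forall>\<^sub>F k in sequentially. (\<integral>x. f (N k) x * indicator X x \<partial>w) = measure \<nu> X"
        using eventually_ge_at_top[of n]
      proof eventually_elim
        fix k assume "n \<le> k"
        then have "n \<le> N k" using Nk[of k] by simp
        then show "(\<integral>x. f (N k) x * indicator X x \<partial>w) = measure \<nu> X"
          unfolding X by (rule integral_f_indicator)
      qed
    qed
    ultimately have "measure \<nu> X = (\<integral>x. ?\<rho> x * indicator X x \<partial>w)"
      using LIMSEQ_unique by blast
    then have "emeasure \<nu> X = ennreal (\<integral>x. ?\<rho> x * indicator X x \<partial>w)"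
      by (simp add: \<nu>.emeasure_eq_measure)
    also have "\<dots> = (\<integral>\<^sup>+x. ennreal (?\<rho> x * indicator X x) \<partial>w)"
      by (rule nn_integral_eq_integral[symmetric]) (auto intro!: integrable_bounded[where c = 1] split: split_indicator)
    also have "\<dots> = emeasure (density w (\<lambda>x. ennreal (?\<rho> x))) X"
      by (subst emeasure_density) (auto intro!: nn_integral_cong split: split_indicator)
    finally show "emeasure \<nu> X = emeasure (density w (\<lambda>x. ennreal (?\<rho> x))) X" .
  next
    show "range (\<lambda>_. UNIV) \<subseteq> ?E" by (auto intro!: exI[of _ UNIV])
  qed (auto simp: sig)
qed

end

section \<open>A Radon-Nikodym theorem with joint measurability\<close>

lemma borel_generating_sequence:
  obtains B :: "nat \<Rightarrow> 'a::second_countable_topology set"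
  where "\<And>i. B i \<in> sets borel" and "sets (borel :: 'a measure) = sigma_sets UNIV (range B)"
proof -
  obtain \<B> :: "'a set set" where \<B>: "countable \<B>" "topological_basis \<B>"
    using ex_countable_basis by blast
  have "\<B> \<noteq> {}"
    using \<B>(2) topological_basisE[OF \<B>(2) open_UNIV UNIV_I] by blast
  then have r: "range (from_nat_into \<B>) = \<B>"
    using \<B>(1) by (rule range_from_nat_into)
  have eq: "sets (borel :: 'a measure) = sigma_sets UNIV \<B>"
    by (subst borel_eq_countable_basis[OF \<B>]) simp
  show thesis
  proof (rule that[of "from_nat_into \<B>"])
    show "from_nat_into \<B> i \<in> sets borel" for i
      unfolding eq using r by (intro sigma_sets.Basic) blast
  qed (simp add: r eq)
qed

text \<open>The locale results are applied at each fixed \<open>z\<close>. Measurability in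
  \<open>z\<close> is separate: the formula uses only measures of cells, and the level
  \<open>N k z\<close> depends measurably on \<open>z\<close>.\<close>

lemma kernel_density:
  fixes \<nu> w :: "'z \<Rightarrow> 'a::second_countable_topology measure"
  assumes \<nu> [measurable]: "\<nu> \<in> Z \<rightarrow>\<^sub>M subprob_algebra borel"
    and w [measurable]: "w \<in> Z \<rightarrow>\<^sub>M subprob_algebra borel"
    and le: "\<And>z A. z \<in> space Z \<Longrightarrow> A \<in> sets borel \<Longrightarrow> emeasure (\<nu> z) A \<le> emeasure (w z) A"
  obtains \<rho> :: "'z \<times> 'a \<Rightarrow> real"
  where "\<rho> \<in> borel_measurable (Z \<Otimes>\<^sub>M borel)" and "\<And>p. 0 \<le> \<rho> p" and "\<And>p. \<rho> p \<le> 1"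
    and "\<And>z. z \<in> space Z \<Longrightarrow> \<nu> z = density (w z) (\<lambda>x. ennreal (\<rho> (z, x)))"
proof -
  obtain B :: "nat \<Rightarrow> 'a set" where B [measurable]: "\<And>i. B i \<in> sets borel"
    and gen: "sets (borel :: 'a measure) = sigma_sets UNIV (range B)"
    by (rule borel_generating_sequence) blast
  have [measurable]: "cell B n S \<in> sets borel" for n S by (rule cell_measurable) measurable
  define J where "J z = energy B (\<nu> z) (w z)" for z
  \<comment> \<open>Taking the least index makes \<open>N k\<close> measurable, since its condition
    is a countable conjunction of inequalities measurable in \<open>z\<close>. The clause
    \<open>k \<le> m\<close> forces the levels to infinity.\<close>
  define N where "N k z = (LEAST m. k \<le> m \<and> (\<forall>n. J z n \<le> J z m + (1/4)^k))" for k z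
  define g where "g k p = cell_ratio B (\<nu> (fst p)) (w (fst p)) (N k (fst p)) (snd p)" for k p
  define \<rho> where "\<rho> p = max 0 (min 1 (lim (\<lambda>k. g k p)))" for p
  have [measurable]: "(\<lambda>z. J z n) \<in> borel_measurable Z" for n
    unfolding J_def energy_def by measurable
  have [measurable]: "N k \<in> Z \<rightarrow>\<^sub>M count_space UNIV" for k
    unfolding N_def by measurable
  have g [measurable]: "g k \<in> borel_measurable (Z \<Otimes>\<^sub>M borel)" for k
    unfolding g_def
  \<comment> \<open>The level varies with \<open>z\<close> but takes countably many values, so it is
    enough to treat each fixed level.\<close>
  proof (rule measurable_compose_countable[where g = "\<lambda>p. N k (fst p)"])
    show "(\<lambda>p. cell_ratio B (\<nu> (fst p)) (w (fst p)) n (snd p)) \<in> borel_measurable (Z \<Otimes>\<^sub>M borel)" for n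
      unfolding cell_ratio_eq_sum by measurable
  qed measurable
  show thesis
  proof
    show "\<rho> \<in> borel_measurable (Z \<Otimes>\<^sub>M borel)" unfolding \<rho>_def by measurable
    show "0 \<le> \<rho> p" "\<rho> p \<le> 1" for p by (simp_all add: \<rho>_def)
    fix z assume z: "z \<in> space Z"
    have sets: "sets (\<nu> z) = sets borel" "sets (w z) = sets borel"
      using subprob_measurableD(2)[OF \<nu> z] subprob_measurableD(2)[OF w z] by auto
    interpret sw: subprob_space "w z" using measurable_space[OF w z] by (simp add: space_subprob_algebra)
    interpret D: dominated_measures B "\<nu> z" "w z"
      using sets le[OF z] B gen by unfold_locales auto
    have J_eq: "J z = energy B (\<nu> z) (w z)" by (simp add: J_def)
    have N: "k \<le> N k z \<and> (\<forall>n. J z n \<le> J z (N k z) + (1/4)^k)" for k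
      unfolding N_def
    proof (rule LeastI_ex)
      have bdd: "bdd_above (range (J z))" using D.J_bounded by (auto simp: J_eq intro!: bdd_aboveI2)
      \<comment> \<open>Energies are bounded by the mass of \<open>w z\<close>; an index nearly
        reaching their supremum meets the condition, and monotonicity lets it be raised above
        \<open>k\<close>.\<close>
      have "(SUP n. J z n) - (1/4)^k < (SUP n. J z n)" by simp
      then obtain m where m: "(SUP n. J z n) - (1/4)^k < J z m"
        by (subst (asm) less_cSUP_iff) (use bdd in auto)
      have "J z n \<le> J z (max k m) + (1/4)^k" for n
        using m cSUP_upper[OF UNIV_I bdd, of n] D.J_mono[of m "max k m"] by (simp add: J_eq)
      then show "\<exists>m\<ge>k. \<forall>n. J z n \<le> J z m + (1/4)^k" by (intro exI[of _ "max k m"]) auto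
    qed
    show "\<nu> z = density (w z) (\<lambda>x. ennreal (\<rho> (z, x)))"
      unfolding \<rho>_def g_def fst_conv snd_conv
      by (rule D.nu_eq_density) (use N in \<open>auto simp: J_eq\<close>)
  qed
qed

section \<open>Coding Polish spaces by reals\<close>

text \<open>Base 3 with digits 0 and 1 only: every tail is at most 1/2, so no two digit sequences
  share a value, as can happen in base 2.\<close>

definition ternary :: "(nat \<Rightarrow> bool) \<Rightarrow> real" where
  "ternary c = (\<Sum>j. of_bool (c j) * (1/3) ^ Suc j)"

definition ternary_bit :: "real \<Rightarrow> nat \<Rightarrow> bool" where
  "ternary_bit r j \<longleftrightarrow> \<lfloor>3 ^ Suc j * r\<rfloor> mod 3 = 1"

lemma powers_third_sums: "(\<lambda>j. (1/3 :: real) ^ Suc j) sums (1/2)"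
  using sums_mult[OF geometric_sums[of "1/3 :: real"], of "1/3"] by simp

lemma summable_ternary: "summable (\<lambda>j. of_bool (c j) * (1/3 :: real) ^ Suc j)"
  by (rule summable_comparison_test[OF _ sums_summable[OF powers_third_sums]]) auto

lemma ternary_nonneg: "0 \<le> ternary c"
  unfolding ternary_def by (rule suminf_nonneg[OF summable_ternary]) auto

lemma ternary_le: "ternary c \<le> 1/2"
  unfolding ternary_def sums_unique[OF powers_third_sums]
  by (rule suminf_le[OF _ summable_ternary sums_summable[OF powers_third_sums]]) auto

lemma ternary_shift: "3 * ternary c = of_bool (c 0) + ternary (\<lambda>j. c (Suc j))"
proof -
  have "ternary c = of_bool (c 0) / 3 + (\<Sum>j. of_bool (c (Suc j)) * (1/3) ^ Suc (Suc j))"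
    unfolding ternary_def using suminf_split_head[OF summable_ternary[of c]] by simp
  also have "(\<Sum>j. of_bool (c (Suc j)) * (1/3) ^ Suc (Suc j)) = (1/3 :: real) * ternary (\<lambda>j. c (Suc j))"
    unfolding ternary_def
    by (subst suminf_mult[OF summable_ternary, symmetric]) (simp add: mult_ac)
  finally show ?thesis by simp
qed

text \<open>Multiplying by \<open>3 ^ j\<close> moves the first \<open>j\<close> digits into an
  integer; one more factor 3 puts \<open>c j\<close> in the units place modulo 3, and the floor
  removes the tail, which is below 1.\<close>

lemma ternary_bit_ternary: "ternary_bit (ternary c) j = c j"
proof -
  have "\<exists>m :: int. 3 ^ j * ternary c = of_int m + ternary (\<lambda>i. c (i + j))"
  proof (induction j)
    case (Suc j)
    then obtain m :: int where "3 ^ j * ternary c = of_int m + ternary (\<lambda>i. c (i + j))" by blast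
    then have "3 ^ Suc j * ternary c = of_int (3 * m + of_bool (c j)) + ternary (\<lambda>i. c (i + Suc j))"
      using ternary_shift[of "\<lambda>i. c (i + j)"] by simp
    then show ?case by blast
  qed (auto intro: exI[of _ 0])
  then obtain m :: int where "3 ^ j * ternary c = of_int m + ternary (\<lambda>i. c (i + j))" by blast
  then have "3 ^ Suc j * ternary c = of_int (3 * m + of_bool (c j)) + ternary (\<lambda>i. c (i + Suc j))"
    using ternary_shift[of "\<lambda>i. c (i + j)"] by simp
  moreover have "0 \<le> ternary (\<lambda>i. c (i + Suc j))" "ternary (\<lambda>i. c (i + Suc j)) < 1"
    using ternary_nonneg[of "\<lambda>i. c (i + Suc j)"] ternary_le[of "\<lambda>i. c (i + Suc j)"] by auto
  ultimately have "\<lfloor>3 ^ Suc j * ternary c\<rfloor> = 3 * m + of_bool (c j)"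
    by (intro floor_unique) auto
  then show ?thesis unfolding ternary_bit_def by auto
qed

text \<open>A point is coded by the balls around a dense sequence that contain it, and recovered as a
  limit of the centres. Only a measurable left inverse is needed, not the Borel isomorphism
  theorem.\<close>

lemma polish_real_coding:
  obtains \<iota> :: "'a::polish_space \<Rightarrow> real" and \<pi> :: "real \<Rightarrow> 'a"
  where "\<iota> \<in> borel_measurable borel" and "\<pi> \<in> borel_measurable borel"
    and "\<And>y. \<pi> (\<iota> y) = y" and "\<And>y. 0 \<le> \<iota> y" and "\<And>y. \<iota> y \<le> 1"
proof -
  obtain D :: "'a set" where D: "countable D" "\<And>X. open X \<Longrightarrow> X \<noteq> {} \<Longrightarrow> \<exists>d\<in>D. d \<in> X"
    by (rule countable_dense_setE) blast
  define a where "a = from_nat_into D"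
  have "D \<noteq> {}" using D(2)[of UNIV] by auto
  have dense: "\<exists>i. dist y (a i) < (1/2) ^ n" for y n
  proof -
    have "y \<in> ball y ((1/2) ^ n)" by simp
    then have "\<exists>d\<in>D. d \<in> ball y ((1/2) ^ n)" by (intro D(2)[OF open_ball]) blast
    then obtain d where "d \<in> D" "d \<in> ball y ((1/2) ^ n)" by blast
    then show ?thesis
      unfolding a_def mem_ball using from_nat_into_surj[OF D(1), of d] by metis
  qed
  \<comment> \<open>The index \<open>j\<close> codes a pair: the exponent of the radius and the
    number of the centre.\<close>
  define near where "near y j = (dist y (a (snd (prod_decode j))) < (1/2) ^ fst (prod_decode j))" for y j
  define \<iota> where "\<iota> y = ternary (near y)" for y
  define idx where "idx r n = (LEAST i. ternary_bit r (prod_encode (n, i)))" for r n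
  \<comment> \<open>A real that codes no point may give centres that do not converge. The fallback
    \<open>a 0\<close> makes \<open>g\<close> converge for every \<open>r\<close>, so
    \<open>\<pi>\<close> is a pointwise limit of measurable functions.\<close>
  define g where "g n r = (if Cauchy (\<lambda>n. a (idx r n)) then a (idx r n) else a 0)" for n r
  define \<pi> where "\<pi> r = lim (\<lambda>n. g n r)" for r
  have bit: "ternary_bit (\<iota> y) (prod_encode (n, i)) \<longleftrightarrow> dist y (a i) < (1/2) ^ n" for y n i
    by (simp add: \<iota>_def ternary_bit_ternary near_def)
  have [measurable]: "Measurable.pred borel (\<lambda>r. ternary_bit r j)" for j
    unfolding ternary_bit_def by measurable
  have [measurable]: "(\<lambda>r. idx r n) \<in> borel \<rightarrow>\<^sub>M count_space UNIV" for n
    unfolding idx_def by measurable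
  have [measurable]: "(\<lambda>r. a (idx r n)) \<in> borel_measurable borel" for n
    by (rule measurable_compose[of "\<lambda>r. idx r n" borel "count_space UNIV"]) auto
  have "convergent (\<lambda>n. g n r)" for r
  proof (cases "Cauchy (\<lambda>n. a (idx r n))")
    case True
    then show ?thesis unfolding g_def by (simp only: if_True Cauchy_convergent)
  next
    case False
    then show ?thesis unfolding g_def by (simp only: if_False convergent_const)
  qed
  then have "(\<lambda>n. g n r) \<longlonglongrightarrow> \<pi> r" for r
    by (simp add: \<pi>_def convergent_LIMSEQ_iff)
  then have \<pi>: "\<pi> \<in> borel_measurable borel"
    by (rule borel_measurable_LIMSEQ_metric[rotated]) (unfold g_def, measurable)
  have [measurable]: "Measurable.pred borel (\<lambda>y. near y j)" for j
    unfolding near_def by measurable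
  have \<iota>: "\<iota> \<in> borel_measurable borel"
    unfolding \<iota>_def ternary_def by measurable
  show thesis
  proof (rule that[OF \<iota> \<pi>])
    show "0 \<le> \<iota> y" for y by (simp add: \<iota>_def ternary_nonneg)
    show "\<iota> y \<le> 1" for y using ternary_le[of "near y"] by (simp add: \<iota>_def)
    fix y
    have d: "dist (a (idx (\<iota> y) n)) y < (1/2) ^ n" for n
      unfolding idx_def bit using LeastI_ex[OF dense[of y n]] by (simp add: dist_commute)
    have lim: "(\<lambda>n. a (idx (\<iota> y) n)) \<longlonglongrightarrow> y"
    proof (rule metric_LIMSEQ_I)
      fix e :: real assume "0 < e"
      then have "\<forall>\<^sub>F n in sequentially. (1/2) ^ n < e"
        by (intro order_tendstoD(2)[OF LIMSEQ_realpow_zero]) simp_all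
      then show "\<exists>n0. \<forall>n\<ge>n0. dist (a (idx (\<iota> y) n)) y < e"
        unfolding eventually_sequentially using d less_trans by blast
    qed
    then have "Cauchy (\<lambda>n. a (idx (\<iota> y) n))" by (rule LIMSEQ_imp_Cauchy)
    then show "\<pi> (\<iota> y) = y" using limI[OF lim] by (simp add: \<pi>_def g_def)
  qed
qed

section \<open>Disintegration of kernels\<close>

text \<open>Tested on the set where \<open>g < f\<close>, the hypothesis gives a nonpositive
  integral of a function that is strictly positive there and zero elsewhere, so that set is
  null.\<close>

lemma AE_le_of_density_le:
  fixes f g :: "'a \<Rightarrow> real"
  assumes "finite_measure M"
    and f [measurable]: "f \<in> borel_measurable M" and g [measurable]: "g \<in> borel_measurable M"
    and f01: "\<And>x. 0 \<le> f x" "\<And>x. f x \<le> 1" and g01: "\<And>x. 0 \<le> g x" "\<And>x. g x \<le> 1"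
    and le: "\<And>A. A \<in> sets M \<Longrightarrow> emeasure (density M f) A \<le> emeasure (density M g) A"
  shows "AE x in M. f x \<le> g x"
proof -
  interpret finite_measure M by fact
  define A where "A = {x \<in> space M. g x < f x}"
  have A [measurable]: "A \<in> sets M" unfolding A_def by measurable
  have int: "integrable M (\<lambda>x. h x * indicator A x)"
    if [measurable]: "h \<in> borel_measurable M" and "\<And>x. 0 \<le> h x" "\<And>x. h x \<le> 1" for h :: "'a \<Rightarrow> real"
    using that by (intro integrable_const_bound[where B = 1]) (simp_all split: split_indicator)
  have dens: "emeasure (density M h) A = ennreal (\<integral>x. h x * indicator A x \<partial>M)"
    if [measurable]: "h \<in> borel_measurable M" and h: "\<And>x. 0 \<le> h x" "\<And>x. h x \<le> 1" for h :: "'a \<Rightarrow> real"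
  proof -
    have "emeasure (density M h) A = (\<integral>\<^sup>+x. ennreal (h x * indicator A x) \<partial>M)"
      by (subst emeasure_density) (auto intro!: nn_integral_cong split: split_indicator)
    also have "\<dots> = ennreal (\<integral>x. h x * indicator A x \<partial>M)"
      by (rule nn_integral_eq_integral[OF int[OF that]]) (use h in simp)
    finally show ?thesis .
  qed
  have "0 \<le> (\<integral>x. g x * indicator A x \<partial>M)"
    by (rule integral_nonneg_AE) (use g01 in simp)
  then have "(\<integral>x. f x * indicator A x \<partial>M) \<le> (\<integral>x. g x * indicator A x \<partial>M)"
    using le[OF A] unfolding dens[OF f f01] dens[OF g g01] by (simp only: ennreal_le_iff)
  then have le0: "(\<integral>x. f x * indicator A x - g x * indicator A x \<partial>M) \<le> 0"
    by (simp only: Bochner_Integration.integral_diff[OF int[OF f f01] int[OF g g01]])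
  have nn: "AE x in M. 0 \<le> f x * indicator A x - g x * indicator A x"
    by (rule AE_I2) (simp add: A_def split: split_indicator)
  have "(\<integral>x. f x * indicator A x - g x * indicator A x \<partial>M) = 0"
    using integral_nonneg_AE[OF nn] le0 by linarith
  then have "AE x in M. f x * indicator A x - g x * indicator A x = 0"
    by (simp only: integral_nonneg_eq_0_iff_AE[OF Bochner_Integration.integrable_diff[OF int[OF f f01] int[OF g g01]] nn])
  then show ?thesis
    using AE_space
  proof eventually_elim
    case (elim x)
    then show ?case by (cases "x \<in> A") (simp_all add: A_def)
  qed
qed

section \<open>Rational thresholds, the uniform law and half-lines\<close>

lemma rational_sequence_below:
  fixes r :: real
  assumes "0 < r" "r \<le> 1"
  obtains q :: "nat \<Rightarrow> real"
  where "incseq q" and "\<And>n. q n \<in> \<rat> \<inter> {0..1}" and "\<And>n. q n < r" and "q \<longlonglongrightarrow> r"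
proof -
  \<comment> \<open>The largest dyadic number of level \<open>n\<close> below \<open>r\<close>.
    Ceiling minus one, rather than floor, keeps the inequality strict when \<open>r\<close> is
    itself dyadic.\<close>
  define q :: "nat \<Rightarrow> real" where "q n = of_int (\<lceil>r * 2 ^ n\<rceil> - 1) / 2 ^ n" for n
  have lt: "q n < r" for n
    by (simp add: q_def divide_less_eq) linarith
  have ge: "r - (1/2) ^ n \<le> q n" for n
  proof -
    have "(r - (1/2) ^ n) * 2 ^ n = r * 2 ^ n - 1"
      by (simp add: left_diff_distrib power_mult_distrib[symmetric])
    also have "\<dots> \<le> of_int (\<lceil>r * 2 ^ n\<rceil> - 1)" by simp
    finally show ?thesis by (simp add: q_def le_divide_eq)
  qed
  have nonneg: "0 \<le> q n" for n
  proof -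
    have "0 < \<lceil>r * 2 ^ n\<rceil>" using assms by simp
    then show ?thesis by (simp add: q_def)
  qed
  have inc: "incseq q"
  proof (rule incseq_SucI)
    fix n
    \<comment> \<open>Rounding gives only a strict inequality with 2 on the right; between integers
      this gains the missing unit.\<close>
    have "2 * (\<lceil>y\<rceil> - 1) \<le> \<lceil>2 * y\<rceil> - 1" for y :: real
    proof -
      have "real_of_int (2 * \<lceil>y\<rceil>) < real_of_int (\<lceil>2 * y\<rceil> + 2)"
        using le_of_int_ceiling[of "2 * y"] ceiling_correct[of y]
        unfolding of_int_mult of_int_add of_int_numeral by linarith
      then have "2 * \<lceil>y\<rceil> < \<lceil>2 * y\<rceil> + 2" by (simp only: of_int_less_iff)
      then show ?thesis by simp
    qed
    from this[of "r * 2 ^ n"]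
    have "real_of_int (2 * (\<lceil>r * 2 ^ n\<rceil> - 1)) \<le> of_int (\<lceil>2 * (r * 2 ^ n)\<rceil> - 1)"
      by (simp only: of_int_le_iff)
    then have "real_of_int (2 * (\<lceil>r * 2 ^ n\<rceil> - 1)) / (2 * 2 ^ n) \<le> of_int (\<lceil>2 * (r * 2 ^ n)\<rceil> - 1) / (2 * 2 ^ n)"
      by (rule divide_right_mono) simp
    also have "real_of_int (2 * (\<lceil>r * 2 ^ n\<rceil> - 1)) / (2 * 2 ^ n) = q n"
      unfolding q_def of_int_mult of_int_numeral by (rule mult_divide_mult_cancel_left) simp
    finally show "q n \<le> q (Suc n)" by (simp add: q_def mult_ac)
  qed
  have "q \<longlonglongrightarrow> r"
  proof (rule tendsto_sandwich)
    show "(\<lambda>n. r - (1/2) ^ n) \<longlonglongrightarrow> r"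
      using tendsto_diff[OF tendsto_const[of r] LIMSEQ_realpow_zero[of "1/2"]] by simp
    show "(\<lambda>n. r) \<longlonglongrightarrow> r" by simp
  qed (use lt ge in \<open>auto intro!: always_eventually simp: less_imp_le\<close>)
  moreover have "q n \<in> \<rat> \<inter> {0..1}" for n
  proof -
    have "q n \<in> \<rat>" by (simp add: q_def)
    then show ?thesis using nonneg[of n] lt[of n] assms(2) by auto
  qed
  ultimately show thesis using that[of q] inc lt by blast
qed

abbreviation uniform01 :: "real measure" where
  "uniform01 \<equiv> uniform_measure lborel {0..1}"

lemma prob_space_uniform01: "prob_space uniform01"
  by (rule prob_space_uniform_measure) auto

lemma emeasure_uniform01_atMost:
  assumes "0 \<le> t" "t \<le> 1"
  shows "emeasure uniform01 {..t} = ennreal t"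
proof -
  have "{0..1} \<inter> {..t} = {0..t}" using assms by auto
  then show ?thesis using assms by (simp add: divide_ennreal flip: ennreal_1)
qed

text \<open>Open half-lines match the events \<open>Q < r\<close>: an infimum lies strictly below
  \<open>r\<close> exactly when some member does.\<close>

lemma sets_borel_prod_lessThan:
  "sets (borel \<Otimes>\<^sub>M (borel :: 'x::topological_space measure)) =
     sigma_sets UNIV {{..<r} \<times> B | (r :: real) B. B \<in> sets borel}"
proof -
  have "sets (borel \<Otimes>\<^sub>M (borel :: 'x measure)) =
      sets (sigma (space borel \<times> space borel) {a \<times> b | a b. a \<in> range (lessThan :: real \<Rightarrow> _) \<and> b \<in> sets (borel :: 'x measure)})"
  proof (rule sets_pair_eq)
    show "sets (borel :: real measure) = sigma_sets (space borel) (range lessThan)"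
      by (subst borel_Iio) simp
    show "countable (range (\<lambda>n. {..<real n}))" by simp
    show "\<Union> (range (\<lambda>n. {..<real n})) = space borel"
      using reals_Archimedean2 by auto
    show "countable {UNIV :: 'x set}" by simp
    show "sets (borel :: 'x measure) = sigma_sets (space borel) (sets borel)"
      using sets.sigma_sets_eq[of "borel :: 'x measure"] by simp
  qed auto
  also have "{a \<times> b | a b. a \<in> range (lessThan :: real \<Rightarrow> _) \<and> b \<in> sets (borel :: 'x measure)}
      = {{..<r} \<times> B | (r :: real) B. B \<in> sets borel}" by auto
  finally show ?thesis by simp
qed

text \<open>Conditional quantile transform: a uniform variable is pushed through the generalised inverse of
  a conditional distribution function known only at rational points.\<close>

lemma kernel_disintegration_real:
  fixes v :: "'z \<Rightarrow> (real \<times> 'x::second_countable_topology) measure"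
  assumes v [measurable]: "v \<in> Z \<rightarrow>\<^sub>M subprob_algebra (borel \<Otimes>\<^sub>M borel)"
    and v01: "\<And>z. z \<in> space Z \<Longrightarrow> AE p in v z. 0 \<le> fst p \<and> fst p \<le> 1"
  obtains Q :: "('z \<times> 'x) \<times> real \<Rightarrow> real"
  where "Q \<in> borel_measurable ((Z \<Otimes>\<^sub>M borel) \<Otimes>\<^sub>M borel)"
    and "\<And>z. z \<in> space Z \<Longrightarrow>
      v z = distr (distr (v z) borel snd \<Otimes>\<^sub>M uniform01) (borel \<Otimes>\<^sub>M borel) (\<lambda>(x, u). (Q ((z, x), u), x))"
proof -
  define w where "w z = distr (v z) borel snd" for z
  have w [measurable]: "w \<in> Z \<rightarrow>\<^sub>M subprob_algebra borel"
    unfolding w_def by (rule measurable_compose[OF v measurable_distr]) measurable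
  define E where "E = (\<rat> \<inter> {0..1} :: real set)"
  have E: "countable E" "E \<noteq> {}" and E01: "\<And>q. q \<in> E \<Longrightarrow> 0 \<le> q \<and> q \<le> 1"
    by (auto simp: E_def countable_rat intro: countable_subset[of _ \<rat>])
  \<comment> \<open>The density of \<open>\<nu> q z\<close> with respect to \<open>w z\<close> is
    the conditional distribution function of the first coordinate at \<open>q\<close>.\<close>
  define \<nu> where "\<nu> q z = distr (density (v z) (indicator {p. fst p \<le> q})) borel snd" for q :: real and z
  have sets_v: "sets (v z) = sets (borel \<Otimes>\<^sub>M borel)" and subprob_v: "subprob_space (v z)"
    if "z \<in> space Z" for z
    using measurable_space[OF v that] by (simp_all add: space_subprob_algebra)
  have space_v: "space (v z) = UNIV" if "z \<in> space Z" for z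
    using sets_eq_imp_space_eq[OF sets_v[OF that]] by (simp add: space_pair_measure)
  have meas_v: "measurable (v z) N = measurable (borel \<Otimes>\<^sub>M borel) N" if "z \<in> space Z" for z and N :: "'n measure"
    by (rule measurable_cong_sets[OF sets_v[OF that] refl])
  have w_eq: "emeasure (w z) B = emeasure (v z) {p. snd p \<in> B}"
    if "z \<in> space Z" "B \<in> sets borel" for z B
    unfolding w_def using that
    by (subst emeasure_distr) (auto simp: meas_v space_v vimage_def)
  have C: "{p. fst p \<le> q} \<in> sets (borel \<Otimes>\<^sub>M borel :: (real \<times> 'x) measure)" for q
    using measurable_sets[of fst "borel \<Otimes>\<^sub>M borel" borel "{..q}"] by (simp add: vimage_def space_pair_measure)
  have D: "{p. snd p \<in> B} \<in> sets (borel \<Otimes>\<^sub>M borel :: (real \<times> 'x) measure)" if "B \<in> sets borel" for B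
    using measurable_sets[of snd "borel \<Otimes>\<^sub>M borel" borel B] that by (simp add: vimage_def space_pair_measure)
  have CD: "{p. fst p \<le> q \<and> snd p \<in> B} \<in> sets (borel \<Otimes>\<^sub>M borel :: (real \<times> 'x) measure)"
    if "B \<in> sets borel" for q B
    using sets.Int[OF C[of q] D[OF that]] by (simp add: Collect_conj_eq)
  have \<nu>_eq: "emeasure (\<nu> q z) B = emeasure (v z) {p. fst p \<le> q \<and> snd p \<in> B}"
    if z: "z \<in> space Z" and B: "B \<in> sets borel" for q z B
  proof -
    have "emeasure (\<nu> q z) B = emeasure (density (v z) (indicator {p. fst p \<le> q})) {p. snd p \<in> B}"
      unfolding \<nu>_def using B
      by (subst emeasure_distr) (auto simp: meas_v[OF z] space_v[OF z] vimage_def cong: measurable_cong_sets)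
    also have "\<dots> = emeasure (v z) ({p. fst p \<le> q} \<inter> {p. snd p \<in> B})"
      by (rule emeasure_restricted) (simp_all add: sets_v[OF z] C D B)
    finally show ?thesis by (simp add: Collect_conj_eq)
  qed
  have \<nu> [measurable]: "\<nu> q \<in> Z \<rightarrow>\<^sub>M subprob_algebra borel" for q
  proof (rule measurable_subprob_algebra)
    fix z assume z: "z \<in> space Z"
    interpret subprob_space "v z" by (rule subprob_v[OF z])
    show "sets (\<nu> q z) = sets borel" by (simp add: \<nu>_def)
    have "emeasure (\<nu> q z) UNIV \<le> 1"
      using \<nu>_eq[OF z, of UNIV q] subprob_emeasure_le_1 by simp
    then show "subprob_space (\<nu> q z)" by (intro subprob_spaceI) (simp_all add: \<nu>_def)
  next
    fix B :: "'x set" assume B: "B \<in> sets borel"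
    have "(\<lambda>z. emeasure (v z) {p. fst p \<le> q \<and> snd p \<in> B}) \<in> borel_measurable Z"
      by (rule measurable_compose[OF v measurable_emeasure_subprob_algebra[OF CD[OF B]]])
    then show "(\<lambda>z. emeasure (\<nu> q z) B) \<in> borel_measurable Z"
      by (subst measurable_cong[OF \<nu>_eq[OF _ B]])
  qed
  have "\<exists>\<rho>. \<rho> \<in> borel_measurable (Z \<Otimes>\<^sub>M borel) \<and> (\<forall>p. 0 \<le> \<rho> p \<and> \<rho> p \<le> (1 :: real)) \<and>
      (\<forall>z\<in>space Z. \<nu> q z = density (w z) (\<lambda>x. ennreal (\<rho> (z, x))))" for q
  proof (rule kernel_density[of "\<nu> q" Z w])
    fix z A assume z: "z \<in> space Z" and A: "A \<in> sets (borel :: 'x measure)"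
    show "emeasure (\<nu> q z) A \<le> emeasure (w z) A"
      unfolding \<nu>_eq[OF z A] w_eq[OF z A]
      by (rule emeasure_mono) (auto simp: sets_v[OF z] D[OF A])
  qed (blast intro: \<nu> w)+
  then obtain \<rho> :: "real \<Rightarrow> 'z \<times> 'x \<Rightarrow> real"
    where \<rho>_meas [measurable]: "\<And>q. \<rho> q \<in> borel_measurable (Z \<Otimes>\<^sub>M borel)"
      and \<rho>01: "\<And>q p. 0 \<le> \<rho> q p" "\<And>q p. \<rho> q p \<le> 1"
      and \<rho>: "\<And>q z. z \<in> space Z \<Longrightarrow> \<nu> q z = density (w z) (\<lambda>x. ennreal (\<rho> q (z, x)))"
    by metis
  \<comment> \<open>The value 1 for thresholds that fail keeps the infimum over the fixed countable
    set \<open>E\<close>, hence measurable and never over an empty set. It lies below no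
    \<open>r \<le> 1\<close>, which is the side condition of \<open>Q_less\<close>.\<close>
  define Q where "Q = (\<lambda>(p, u). INF q\<in>E. if u \<le> \<rho> q p then q else 1)"
  have bdd: "bdd_below ((\<lambda>q. if u \<le> \<rho> q p then q else 1) ` E)" for u p
    using E01 by (auto intro!: bdd_belowI[where m = 0])
  have Q [measurable]: "Q \<in> borel_measurable ((Z \<Otimes>\<^sub>M borel) \<Otimes>\<^sub>M borel)"
    unfolding Q_def split_beta' using E(1) by measurable
  have Q_nonneg: "0 \<le> Q (p, u)" for p u
    unfolding Q_def prod.case by (rule cINF_greatest[OF E(2)]) (simp add: E01)
  have Q_le: "Q (p, u) \<le> 1" for p u
  proof -
    obtain q where "q \<in> E" using E(2) by blast
    then show ?thesis
      unfolding Q_def prod.case using E01 by (intro cINF_lower2[OF bdd]) auto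
  qed
  have Q_less: "Q (p, u) < r \<longleftrightarrow> (\<exists>q\<in>E. q < r \<and> u \<le> \<rho> q p)" if "r \<le> 1" for p u r
    unfolding Q_def prod.case cINF_less_iff[OF E(2) bdd] using that by (auto split: if_splits)
  show thesis
  proof (rule that[OF Q])
    fix z assume z: "z \<in> space Z"
    interpret v: subprob_space "v z" by (rule subprob_v[OF z])
    have sets_w: "sets (w z) = sets borel" and space_w: "space (w z) = UNIV"
      by (simp_all add: w_def)
    have fin_w: "finite_measure (w z)"
      unfolding w_def by (rule v.finite_measure_distr) (simp add: meas_v[OF z])
    have \<rho>z: "(\<lambda>x. \<rho> q (z, x)) \<in> borel_measurable (w z)" for q
      unfolding measurable_cong_sets[OF sets_w refl] using z by measurable
    have Qz: "(\<lambda>(x, u). (Q ((z, x), u), x)) \<in> w z \<Otimes>\<^sub>M uniform01 \<rightarrow>\<^sub>M borel \<Otimes>\<^sub>M borel"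
    proof -
      have s: "sets (w z \<Otimes>\<^sub>M uniform01) = sets (borel \<Otimes>\<^sub>M borel)"
        by (rule sets_pair_measure_cong) (simp_all add: sets_w)
      show ?thesis
        unfolding measurable_cong_sets[OF s refl] split_beta' using z by measurable
    qed
    have mono: "AE x in w z. \<rho> p (z, x) \<le> \<rho> q (z, x)" if "p \<le> q" for p q
    proof (rule AE_le_of_density_le[OF fin_w])
      fix A assume "A \<in> sets (w z)"
      then have A: "A \<in> sets borel" by (simp add: sets_w)
      show "emeasure (density (w z) (\<lambda>x. ennreal (\<rho> p (z, x)))) A
          \<le> emeasure (density (w z) (\<lambda>x. ennreal (\<rho> q (z, x)))) A"
        unfolding \<rho>[OF z, symmetric] \<nu>_eq[OF z A]
        using that by (intro emeasure_mono) (auto simp: sets_v[OF z] CD[OF A])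
    qed (rule \<rho>z \<rho>01)+
    \<comment> \<open>Only countably many pairs of thresholds occur, so their exceptional sets merge
      into one null set.\<close>
    have cdf: "AE x in w z. \<forall>p\<in>E. \<forall>q\<in>E. p \<le> q \<longrightarrow> \<rho> p (z, x) \<le> \<rho> q (z, x)"
      using mono by (simp add: AE_ball_countable E(1))
    \<comment> \<open>Both sides are approached from below along rationals \<open>q n\<close>
      increasing to \<open>r\<close>: monotone convergence handles the integral, continuity from
      below handles \<open>v z\<close>. They agree at each \<open>n\<close> because
      \<open>\<rho> (q n)\<close> is the density of \<open>\<nu> (q n) z\<close>.\<close>
    have key: "emeasure (v z) {p. fst p < r \<and> snd p \<in> B} =
        (\<integral>\<^sup>+x. emeasure uniform01 {u. Q ((z, x), u) < r} * indicator B x \<partial>w z)"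
      if r: "0 < r" "r \<le> 1" and B: "B \<in> sets borel" for r B
    proof -
      obtain q where q: "incseq q" "\<And>n. q n \<in> E" "\<And>n. q n < r" "q \<longlonglongrightarrow> r"
        using rational_sequence_below[OF r] unfolding E_def by blast
      have q_above: "\<exists>n. s \<le> q n" if "s < r" for s
        using order_tendstoD(1)[OF q(4) that] by (auto simp: eventually_sequentially intro: less_imp_le)
      have U: "AE x in w z. emeasure uniform01 {u. Q ((z, x), u) < r} = (SUP n. ennreal (\<rho> (q n) (z, x)))"
        using cdf
      proof eventually_elim
        fix x assume m: "\<forall>p\<in>E. \<forall>q\<in>E. p \<le> q \<longrightarrow> \<rho> p (z, x) \<le> \<rho> q (z, x)"
        \<comment> \<open>Monotonicity in the threshold lets any qualifying \<open>s < r\<close> be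
          replaced by some \<open>q n\<close> above it; this is where the common null set is left
          out.\<close>
        have "{u. Q ((z, x), u) < r} = (\<Union>n. {..\<rho> (q n) (z, x)})"
        proof (intro set_eqI iffI)
          fix u assume "u \<in> {u. Q ((z, x), u) < r}"
          then obtain s where s: "s \<in> E" "s < r" "u \<le> \<rho> s (z, x)" by (auto simp: Q_less[OF r(2)])
          from q_above[OF s(2)] obtain n where "s \<le> q n" ..
          then show "u \<in> (\<Union>n. {..\<rho> (q n) (z, x)})" using m s q(2) order_trans by blast
        qed (use q(2,3) in \<open>auto simp: Q_less[OF r(2)]\<close>)
        moreover have "incseq (\<lambda>n. {..\<rho> (q n) (z, x)})"
          using m q(1,2) by (auto simp: incseq_def)
        ultimately have "emeasure uniform01 {u. Q ((z, x), u) < r} = (SUP n. emeasure uniform01 {..\<rho> (q n) (z, x)})"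
          by (simp only:) (rule SUP_emeasure_incseq[symmetric], auto)
        then show "emeasure uniform01 {u. Q ((z, x), u) < r} = (SUP n. ennreal (\<rho> (q n) (z, x)))"
          by (simp only: emeasure_uniform01_atMost \<rho>01)
      qed
      have "(\<integral>\<^sup>+x. emeasure uniform01 {u. Q ((z, x), u) < r} * indicator B x \<partial>w z)
          = (\<integral>\<^sup>+x. (SUP n. ennreal (\<rho> (q n) (z, x)) * indicator B x) \<partial>w z)"
      proof (rule nn_integral_cong_AE)
        show "AE x in w z. emeasure uniform01 {u. Q ((z, x), u) < r} * indicator B x =
            (SUP n. ennreal (\<rho> (q n) (z, x)) * indicator B x)"
          using U by eventually_elim (simp add: SUP_mult_right_ennreal)
      qed
      also have "\<dots> = (SUP n. \<integral>\<^sup>+x. ennreal (\<rho> (q n) (z, x)) * indicator B x \<partial>w z)"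
      proof (rule nn_integral_monotone_convergence_SUP_AE)
        fix n
        have "q n \<le> q (Suc n)" using q(1) by (simp add: incseq_SucD)
        from mono[OF this]
        show "AE x in w z. ennreal (\<rho> (q n) (z, x)) * indicator B x \<le> ennreal (\<rho> (q (Suc n)) (z, x)) * indicator B x"
          by eventually_elim (auto intro!: mult_right_mono ennreal_leI)
        show "(\<lambda>x. ennreal (\<rho> (q n) (z, x)) * indicator B x) \<in> borel_measurable (w z)"
          by (intro borel_measurable_times_ennreal measurable_compose[OF \<rho>z measurable_ennreal]
              borel_measurable_indicator) (simp add: sets_w B)
      qed
      also have "\<dots> = (SUP n. emeasure (v z) {p. fst p \<le> q n \<and> snd p \<in> B})"
      proof (rule SUP_cong[OF refl])
        fix n
        have "emeasure (v z) {p. fst p \<le> q n \<and> snd p \<in> B} = emeasure (density (w z) (\<lambda>x. ennreal (\<rho> (q n) (z, x)))) B"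
          by (simp only: \<nu>_eq[OF z B, symmetric] \<rho>[OF z])
        also have "\<dots> = (\<integral>\<^sup>+x. ennreal (\<rho> (q n) (z, x)) * indicator B x \<partial>w z)"
          by (rule emeasure_density) (use \<rho>z B in \<open>simp_all add: sets_w\<close>)
        finally show "(\<integral>\<^sup>+x. ennreal (\<rho> (q n) (z, x)) * indicator B x \<partial>w z) =
            emeasure (v z) {p. fst p \<le> q n \<and> snd p \<in> B}" ..
      qed
      also have "\<dots> = emeasure (v z) (\<Union>n. {p. fst p \<le> q n \<and> snd p \<in> B})"
      proof (rule SUP_emeasure_incseq)
        show "range (\<lambda>n. {p. fst p \<le> q n \<and> snd p \<in> B}) \<subseteq> sets (v z)"
          using CD[OF B] by (simp add: image_subset_iff sets_v[OF z])
        show "incseq (\<lambda>n. {p. fst p \<le> q n \<and> snd p \<in> B})"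
          by (rule incseq_SucI) (use incseq_SucD[OF q(1)] order_trans in blast)
      qed
      also have "(\<Union>n. {p. fst p \<le> q n \<and> snd p \<in> B}) = {p. fst p < r \<and> snd p \<in> B}"
        using q_above le_less_trans[OF _ q(3)] by blast
      finally show ?thesis ..
    qed
    \<comment> \<open>Outside the range of \<open>key\<close> both sides are immediate, since
      \<open>Q\<close> and almost every first coordinate lie in [0, 1].\<close>
    have rect: "emeasure (v z) ({..<r} \<times> B) =
        (\<integral>\<^sup>+x. emeasure uniform01 {u. Q ((z, x), u) < r} * indicator B x \<partial>w z)"
      if B: "B \<in> sets borel" for r B
    proof -
      have X: "{..<r} \<times> B = {p. fst p < r \<and> snd p \<in> B}" by auto
      consider "r \<le> 0" | "0 < r" "r \<le> 1" | "1 < r" by linarith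
      then show ?thesis
      proof cases
        case 1
        have "emeasure (v z) ({..<r} \<times> B) = emeasure (v z) {}"
        proof (rule emeasure_eq_AE)
          show "AE p in v z. p \<in> {..<r} \<times> B \<longleftrightarrow> p \<in> {}"
            using v01[OF z] by eventually_elim (use 1 in auto)
        qed (simp_all add: sets_v[OF z] B)
        moreover have "{u. Q ((z, x), u) < r} = {}" for x
          using order_trans[OF 1 Q_nonneg] by (simp add: not_less)
        ultimately show ?thesis by simp
      next
        case 2
        then show ?thesis unfolding X by (rule key[OF _ _ B])
      next
        case 3
        have "emeasure (v z) ({..<r} \<times> B) = emeasure (v z) {p. snd p \<in> B}"
        proof (rule emeasure_eq_AE)
          show "AE p in v z. p \<in> {..<r} \<times> B \<longleftrightarrow> p \<in> {p. snd p \<in> B}"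
            using v01[OF z] by eventually_elim (use 3 in auto)
        qed (simp_all add: sets_v[OF z] B D)
        moreover have "{u. Q ((z, x), u) < r} = UNIV" for x
          using le_less_trans[OF Q_le 3] by simp
        moreover have "emeasure uniform01 UNIV = 1"
          using prob_space.emeasure_space_1[OF prob_space_uniform01] by simp
        ultimately show ?thesis using B by (simp add: w_eq[OF z B, symmetric] sets_w)
      qed
    qed
    interpret U: prob_space uniform01 by (rule prob_space_uniform01)
    let ?M = "distr (w z \<Otimes>\<^sub>M uniform01) (borel \<Otimes>\<^sub>M borel) (\<lambda>(x, u). (Q ((z, x), u), x))"
    have "v z = ?M"
    proof (rule measure_eqI_generator_eq[where \<Omega> = UNIV and A = "\<lambda>n. {..<real n} \<times> UNIV"
          and E = "{{..<r} \<times> B | (r :: real) (B :: 'x set). B \<in> sets borel}"])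
      show "Int_stable {{..<r} \<times> B | (r :: real) (B :: 'x set). B \<in> sets borel}"
      proof (intro Int_stableI, clarify)
        fix r s :: real and A B :: "'x set" assume "A \<in> sets borel" "B \<in> sets borel"
        moreover have "{..<r} \<times> A \<inter> {..<s} \<times> B = {..<min r s} \<times> (A \<inter> B)" by auto
        ultimately show "\<exists>r' B'. {..<r} \<times> A \<inter> {..<s} \<times> B = {..<r'} \<times> B' \<and> B' \<in> sets borel" by blast
      qed
      fix X assume "X \<in> {{..<r} \<times> B | (r :: real) (B :: 'x set). B \<in> sets borel}"
      then obtain r and B :: "'x set" where X: "X = {..<r} \<times> B" and B: "B \<in> sets borel" by blast
      let ?P = "(\<lambda>(x, u). (Q ((z, x), u), x)) -` X \<inter> space (w z \<Otimes>\<^sub>M uniform01)"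
      have "emeasure ?M X = emeasure (w z \<Otimes>\<^sub>M uniform01) ?P"
        by (rule emeasure_distr[OF Qz]) (simp add: X B)
      also have "\<dots> = (\<integral>\<^sup>+x. emeasure uniform01 (Pair x -` ?P) \<partial>w z)"
        by (rule U.emeasure_pair_measure_alt, rule measurable_sets[OF Qz]) (simp add: X B)
      also have "\<dots> = (\<integral>\<^sup>+x. emeasure uniform01 {u. Q ((z, x), u) < r} * indicator B x \<partial>w z)"
      proof (rule nn_integral_cong)
        fix x
        have "Pair x -` ?P = (if x \<in> B then {u. Q ((z, x), u) < r} else {})"
          by (auto simp: X space_pair_measure space_w)
        then show "emeasure uniform01 (Pair x -` ?P) = emeasure uniform01 {u. Q ((z, x), u) < r} * indicator B x"
          by simp
      qed
      finally show "emeasure (v z) X = emeasure ?M X" unfolding X rect[OF B] by simp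
    next
      show "(\<Union>i. {..<real i} \<times> (UNIV :: 'x set)) = UNIV" using reals_Archimedean2 by auto
      show "range (\<lambda>n. {..<real n} \<times> UNIV) \<subseteq> {{..<r} \<times> B | (r :: real) (B :: 'x set). B \<in> sets borel}"
      proof (rule image_subsetI)
        show "{..<real n} \<times> UNIV \<in> {{..<r} \<times> B | (r :: real) (B :: 'x set). B \<in> sets borel}" for n
          by (rule CollectI, intro exI conjI, rule refl, simp)
      qed
    qed (simp_all add: sets_v[OF z] sets_borel_prod_lessThan)
    then show "v z = distr (distr (v z) borel snd \<Otimes>\<^sub>M uniform01) (borel \<Otimes>\<^sub>M borel) (\<lambda>(x, u). (Q ((z, x), u), x))"
      by (simp only: w_def)
  qed
qed

text \<open>The first coordinate is coded by \<open>\<iota>\<close>, disintegrated as a real, and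
  decoded by \<open>\<pi>\<close>. As \<open>\<pi>\<close> inverts \<open>\<iota>\<close> on the
  left, pushing the coded measure forward by \<open>\<pi>\<close> recovers \<open>v z\<close>
  exactly.\<close>

theorem kernel_disintegration:
  fixes v :: "'z \<Rightarrow> ('a::polish_space \<times> 'x::second_countable_topology) measure"
  assumes v [measurable]: "v \<in> Z \<rightarrow>\<^sub>M subprob_algebra (borel \<Otimes>\<^sub>M borel)"
  obtains k :: "'z \<times> 'x \<Rightarrow> 'a measure"
  where "k \<in> Z \<Otimes>\<^sub>M borel \<rightarrow>\<^sub>M prob_algebra borel"
    and "\<And>z A. z \<in> space Z \<Longrightarrow> A \<in> sets (borel \<Otimes>\<^sub>M borel) \<Longrightarrow>
      emeasure (v z) A = (\<integral>\<^sup>+x. emeasure (k (z, x)) ((\<lambda>y. (y, x)) -` A) \<partial>distr (v z) borel snd)"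
proof -
  obtain \<iota> :: "'a \<Rightarrow> real" and \<pi> :: "real \<Rightarrow> 'a"
    where [measurable]: "\<iota> \<in> borel_measurable borel" "\<pi> \<in> borel_measurable borel"
      and \<pi>\<iota>: "\<And>y. \<pi> (\<iota> y) = y" and \<iota>01: "\<And>y. 0 \<le> \<iota> y" "\<And>y. \<iota> y \<le> 1"
    by (rule polish_real_coding) blast
  have \<iota>_meas: "map_prod \<iota> id \<in> borel \<Otimes>\<^sub>M borel \<rightarrow>\<^sub>M borel \<Otimes>\<^sub>M (borel :: 'x measure)"
    and \<pi>_meas: "map_prod \<pi> id \<in> borel \<Otimes>\<^sub>M borel \<rightarrow>\<^sub>M borel \<Otimes>\<^sub>M (borel :: 'x measure)"
    unfolding map_prod_def id_def by measurable
  define v' where "v' z = distr (v z) (borel \<Otimes>\<^sub>M borel) (map_prod \<iota> id)" for z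
  have sets_v: "sets (v z) = sets (borel \<Otimes>\<^sub>M borel)" if "z \<in> space Z" for z
    using measurable_space[OF v that] by (simp add: space_subprob_algebra)
  have meas_v: "measurable (v z) N = measurable (borel \<Otimes>\<^sub>M borel) N" if "z \<in> space Z" for z and N :: "'n measure"
    by (rule measurable_cong_sets[OF sets_v[OF that] refl])
  have v': "v' \<in> Z \<rightarrow>\<^sub>M subprob_algebra (borel \<Otimes>\<^sub>M borel)"
    unfolding v'_def by (rule measurable_compose[OF v measurable_distr[OF \<iota>_meas]])
  have v'01: "AE p in v' z. 0 \<le> fst p \<and> fst p \<le> 1" if "z \<in> space Z" for z
    unfolding v'_def
  proof (subst AE_distr_iff)
    show "map_prod \<iota> id \<in> v z \<rightarrow>\<^sub>M borel \<Otimes>\<^sub>M borel" using \<iota>_meas by (simp add: meas_v[OF that])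
  qed (simp_all add: \<iota>01)
  obtain Q :: "('z \<times> 'x) \<times> real \<Rightarrow> real"
    where Q [measurable]: "Q \<in> borel_measurable ((Z \<Otimes>\<^sub>M borel) \<Otimes>\<^sub>M borel)"
      and v'_eq: "\<And>z. z \<in> space Z \<Longrightarrow>
        v' z = distr (distr (v' z) borel snd \<Otimes>\<^sub>M uniform01) (borel \<Otimes>\<^sub>M borel) (\<lambda>(x, u). (Q ((z, x), u), x))"
    using kernel_disintegration_real[OF v' v'01] by blast
  \<comment> \<open>As an image of the uniform law this is a probability measure for every
    \<open>p\<close>, also when \<open>Q (p, u)\<close> is not a code.\<close>
  define k where "k p = distr uniform01 borel (\<lambda>u. \<pi> (Q (p, u)))" for p
  show thesis
  proof (rule that)
    show "k \<in> Z \<Otimes>\<^sub>M borel \<rightarrow>\<^sub>M prob_algebra borel"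
      unfolding k_def
    proof (rule measurable_distr_prob_space2[where M = borel])
      show "(\<lambda>_. uniform01) \<in> Z \<Otimes>\<^sub>M borel \<rightarrow>\<^sub>M prob_algebra borel"
        by (rule measurable_const) (simp add: space_prob_algebra prob_space_uniform01)
    qed measurable
    fix z and A :: "('a \<times> 'x) set"
    assume z: "z \<in> space Z" and A: "A \<in> sets (borel \<Otimes>\<^sub>M borel)"
    define w where "w = distr (v z) borel snd"
    have sets_w: "sets (w \<Otimes>\<^sub>M uniform01) = sets (borel \<Otimes>\<^sub>M borel)"
      by (rule sets_pair_measure_cong) (simp_all add: w_def)
    have w_eq: "distr (v' z) borel snd = w"
      unfolding v'_def w_def using \<iota>_meas
      by (subst distr_distr) (auto simp: meas_v[OF z] comp_def)
    have Qz: "(\<lambda>(x, u). (Q ((z, x), u), x)) \<in> w \<Otimes>\<^sub>M uniform01 \<rightarrow>\<^sub>M borel \<Otimes>\<^sub>M borel"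
      unfolding measurable_cong_sets[OF sets_w refl] split_beta' using z by measurable
    let ?T = "\<lambda>(x, u). (\<pi> (Q ((z, x), u)), x)"
    have T: "?T \<in> w \<Otimes>\<^sub>M uniform01 \<rightarrow>\<^sub>M borel \<Otimes>\<^sub>M borel"
      unfolding measurable_cong_sets[OF sets_w refl] split_beta' using z by measurable
    have "v z = distr (v' z) (borel \<Otimes>\<^sub>M borel) (map_prod \<pi> id)"
    proof -
      have "distr (v' z) (borel \<Otimes>\<^sub>M borel) (map_prod \<pi> id) = distr (v z) (borel \<Otimes>\<^sub>M borel) (map_prod \<pi> id \<circ> map_prod \<iota> id)"
        unfolding v'_def using \<iota>_meas \<pi>_meas by (intro distr_distr) (auto simp: meas_v[OF z])
      also have "map_prod \<pi> id \<circ> map_prod \<iota> (id :: 'x \<Rightarrow> 'x) = (\<lambda>p. p)"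
        by (auto simp: \<pi>\<iota>)
      also have "distr (v z) (borel \<Otimes>\<^sub>M borel) (\<lambda>p. p) = v z"
        by (rule distr_id2) (simp add: sets_v[OF z])
      finally show ?thesis ..
    qed
    also have "\<dots> = distr (w \<Otimes>\<^sub>M uniform01) (borel \<Otimes>\<^sub>M borel) (map_prod \<pi> id \<circ> (\<lambda>(x, u). (Q ((z, x), u), x)))"
      by (subst v'_eq[OF z], unfold w_eq) (rule distr_distr[OF \<pi>_meas Qz])
    also have "map_prod \<pi> id \<circ> (\<lambda>(x, u). (Q ((z, x), u), x)) = ?T"
      by auto
    finally have v_eq: "v z = distr (w \<Otimes>\<^sub>M uniform01) (borel \<Otimes>\<^sub>M borel) ?T" .
    interpret U: prob_space uniform01 by (rule prob_space_uniform01)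
    have space_w: "space w = UNIV" by (simp add: w_def)
    let ?P = "?T -` A \<inter> space (w \<Otimes>\<^sub>M uniform01)"
    have "emeasure (v z) A = emeasure (w \<Otimes>\<^sub>M uniform01) ?P"
      by (subst v_eq) (rule emeasure_distr[OF T A])
    also have "\<dots> = (\<integral>\<^sup>+x. emeasure uniform01 (Pair x -` ?P) \<partial>w)"
      by (rule U.emeasure_pair_measure_alt, rule measurable_sets[OF T A])
    also have "\<dots> = (\<integral>\<^sup>+x. emeasure (k (z, x)) ((\<lambda>y. (y, x)) -` A) \<partial>w)"
    proof (rule nn_integral_cong)
      fix x
      have Ax: "(\<lambda>y. (y, x)) -` A \<in> sets borel"
        using measurable_sets[of "\<lambda>y. (y, x)" borel "borel \<Otimes>\<^sub>M borel" A] A by simp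
      have "(\<lambda>u. \<pi> (Q ((z, x), u))) \<in> uniform01 \<rightarrow>\<^sub>M borel"
        using z by (simp cong: measurable_cong_sets)
      then have "emeasure (k (z, x)) ((\<lambda>y. (y, x)) -` A) = emeasure uniform01 ((\<lambda>u. \<pi> (Q ((z, x), u))) -` (\<lambda>y. (y, x)) -` A)"
        unfolding k_def using Ax by (subst emeasure_distr) simp_all
      also have "(\<lambda>u. \<pi> (Q ((z, x), u))) -` (\<lambda>y. (y, x)) -` A = Pair x -` ?P"
        by (auto simp: space_pair_measure space_w)
      finally show "emeasure uniform01 (Pair x -` ?P) = emeasure (k (z, x)) ((\<lambda>y. (y, x)) -` A)" ..
    qed
    finally show "emeasure (v z) A = (\<integral>\<^sup>+x. emeasure (k (z, x)) ((\<lambda>y. (y, x)) -` A) \<partial>distr (v z) borel snd)"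
      by (simp only: w_def)
  qed
qed

section \<open>Control refinement\<close>

theorem theorem2:
  fixes Mh :: "('xh::polish_space, 'uh::polish_space, 'y::metric_space) gmdp"
    and M :: "('x::polish_space, 'u::polish_space, 'y) gmdp"
    and \<epsilon> \<delta> :: real
    and R :: "('xh \<times> 'x) set"
    and I :: "'xh \<Rightarrow> 'x \<Rightarrow> 'uh \<Rightarrow> 'u measure"
    and v :: "'xh \<Rightarrow> 'x \<Rightarrow> 'uh \<Rightarrow> ('xh \<times> 'x) measure"
  assumes "is_gmdp Mh" and "is_gmdp M"
    and "0 \<le> \<delta>" and "\<delta> \<le> 1"
    and "sub_sim_witness Mh M \<epsilon> \<delta> R I v"
  shows "\<exists>s :: 'xh \<Rightarrow> 'x \<Rightarrow> 'x \<Rightarrow> 'uh \<Rightarrow> 'xh measure.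
           state_mapping s \<and> valid_refinement s (trans M) R I v"
proof -
  let ?Z = "borel \<Otimes>\<^sub>M borel \<Otimes>\<^sub>M borel :: ('xh \<times> 'x \<times> 'uh) measure"
  have v: "(\<lambda>(xh, x, uh). v xh x uh) \<in> ?Z \<rightarrow>\<^sub>M subprob_algebra (borel \<Otimes>\<^sub>M borel)"
    and I: "(\<lambda>(xh, x, uh). I xh x uh) \<in> ?Z \<rightarrow>\<^sub>M prob_algebra borel"
    and coupling: "\<And>xh x uh. (xh, x) \<in> R \<Longrightarrow>
      sub_coupling (trans Mh xh uh) (trans_I (trans M) I xh x uh) R \<delta> (v xh x uh)"
    using assms(5) unfolding sub_sim_witness_def interface_fun_def by auto
  have t: "(\<lambda>(x, u). trans M x u) \<in> borel \<Otimes>\<^sub>M borel \<rightarrow>\<^sub>M prob_algebra borel"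
    using assms(2) unfolding is_gmdp_def by auto
  obtain k :: "('xh \<times> 'x \<times> 'uh) \<times> 'x \<Rightarrow> 'xh measure"
    where k [measurable]: "k \<in> ?Z \<Otimes>\<^sub>M borel \<rightarrow>\<^sub>M prob_algebra borel"
      and dis: "\<And>z A. z \<in> space ?Z \<Longrightarrow> A \<in> sets (borel \<Otimes>\<^sub>M borel) \<Longrightarrow>
        emeasure ((\<lambda>(xh, x, uh). v xh x uh) z) A =
        (\<integral>\<^sup>+x. emeasure (k (z, x)) ((\<lambda>y. (y, x)) -` A) \<partial>distr ((\<lambda>(xh, x, uh). v xh x uh) z) borel snd)"
    using kernel_disintegration[OF v] by blast
  \<comment> \<open>\<open>k\<close> is available at every triple, inside \<open>R\<close> or not,
    so \<open>s\<close> is a kernel on the whole space; \<open>R\<close> enters only through the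
    coupling condition.\<close>
  define s where "s xh x x' uh = k ((xh, x, uh), x')" for xh x x' uh
  have "state_mapping s"
    unfolding state_mapping_def s_def split_beta' by measurable
  moreover have "valid_refinement s (trans M) R I v"
    unfolding valid_refinement_def
  proof clarify
    fix xh x uh and A :: "('xh \<times> 'x) set"
    assume R: "(xh, x) \<in> R" and A: "A \<in> sets (borel \<Otimes>\<^sub>M borel)"
    define p where "p = trans_I (trans M) I xh x uh"
    define w where "w = distr (v xh x uh) borel snd"
    have sets_v: "sets (v xh x uh) = sets (borel \<Otimes>\<^sub>M borel)"
      and marg: "\<And>B. B \<in> sets borel \<Longrightarrow> emeasure (v xh x uh) (UNIV \<times> B) \<le> emeasure p B"
      using coupling[OF R, of uh] unfolding sub_coupling_def p_def by auto
    have space_v: "space (v xh x uh) = UNIV"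
      using sets_eq_imp_space_eq[OF sets_v] by (simp add: space_pair_measure)
    have I_x: "I xh x uh \<in> space (prob_algebra borel)"
      using measurable_space[OF I, of "(xh, x, uh)"] by (simp add: space_pair_measure)
    have t_x: "(\<lambda>u. trans M x u) \<in> borel \<rightarrow>\<^sub>M prob_algebra borel"
      using measurable_compose[OF measurable_Pair1' t] by simp
    have p: "p \<in> space (prob_algebra borel)"
      unfolding p_def trans_I_def
      using measurable_space[OF measurable_bind_prob_space[OF measurable_ident t_x] I_x] by simp
    then have sets_p: "sets p = sets borel" by (simp add: space_prob_algebra)
    have w_le: "w \<le> p"
    proof (subst le_measure)
      show "sets w = sets p" by (simp add: w_def sets_p)
      show "\<forall>B\<in>sets w. emeasure w B \<le> emeasure p B"
      proof
        fix B assume "B \<in> sets w"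
        then have B: "B \<in> sets borel" by (simp add: w_def)
        have "emeasure w B = emeasure (v xh x uh) (snd -` B \<inter> space (v xh x uh))"
          unfolding w_def by (rule emeasure_distr) (simp_all add: B measurable_cong_sets[OF sets_v refl])
        also have "snd -` B \<inter> space (v xh x uh) = UNIV \<times> B" by (auto simp: space_v)
        finally show "emeasure w B \<le> emeasure p B" using marg[OF B] by simp
      qed
    qed
    have "emeasure (v xh x uh) A = (\<integral>\<^sup>+x'. emeasure (s xh x x' uh) ((\<lambda>y. (y, x')) -` A) \<partial>w)"
      using dis[OF _ A, of "(xh, x, uh)"] by (simp add: space_pair_measure s_def w_def)
    \<comment> \<open>The only inequality of the chain: enlarging \<open>w\<close> to
      \<open>p\<close> adds mass, and this surplus is the part of \<open>trans_times\<close> not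
      covered by \<open>v\<close>.\<close>
    also have "\<dots> \<le> (\<integral>\<^sup>+x'. emeasure (s xh x x' uh) ((\<lambda>y. (y, x')) -` A) \<partial>p)"
      by (rule nn_integral_mono_measure[OF _ w_le]) (simp add: w_def sets_p)
    also have "\<dots> = (\<integral>\<^sup>+x'. emeasure (distr (s xh x x' uh) (borel \<Otimes>\<^sub>M borel) (\<lambda>y. (y, x'))) A \<partial>p)"
    proof (rule nn_integral_cong)
      fix x'
      have "k ((xh, x, uh), x') \<in> space (prob_algebra borel)"
        by (rule measurable_space[OF k]) (simp add: space_pair_measure)
      then have sets_s: "sets (s xh x x' uh) = sets borel" by (simp add: space_prob_algebra s_def)
      then have "space (s xh x x' uh) = UNIV" using sets_eq_imp_space_eq by fastforce
      then show "emeasure (s xh x x' uh) ((\<lambda>y. (y, x')) -` A) =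
          emeasure (distr (s xh x x' uh) (borel \<Otimes>\<^sub>M borel) (\<lambda>y. (y, x'))) A"
        using A by (subst emeasure_distr) (simp_all add: measurable_cong_sets[OF sets_s refl])
    qed
    also have "\<dots> = emeasure (trans_times s (trans M) I xh x uh) A"
      unfolding trans_times_def p_def[symmetric]
    proof (rule emeasure_bind_prob_algebra[symmetric, OF p _ A])
      show "(\<lambda>x'. distr (s xh x x' uh) (borel \<Otimes>\<^sub>M borel) (\<lambda>y. (y, x'))) \<in> borel \<rightarrow>\<^sub>M prob_algebra (borel \<Otimes>\<^sub>M borel)"
        unfolding s_def by (rule measurable_distr_prob_space2[where M = borel]) measurable
    qed
    finally show "emeasure (v xh x uh) A \<le> emeasure (trans_times s (trans M) I xh x uh) A" .
  qed
  ultimately show ?thesis by blast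
qed

end
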